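(* Let $\mathcal{A}$ be a complex subspace arrangement in $\mathbb{C}^l$, $x_0\in\mathcal{A}$, and let $\mathcal{A}'$ and $\mathcal{A}''$ be the deleted and restricted arrangements with respect to $x_0$. Then there is a long exact sequence in rational cohomology $$\cdots\to H^q(M(\mathcal{A}'),\mathbb{Q})\to H^q(M(\mathcal{A}),\mathbb{Q})\to H^{q-\deg(x_0)}(M(\mathcal{A}''),\mathbb{Q})\to H^{q+1}(M(\mathcal{A}'),\mathbb{Q})\to\cdots$$ where $\deg(x_0)=2\operatorname{codim}x_0-1$.
   Context: A complex subspace arrangement in $\mathbb{C}^l$ is a finite set $\mathcal{A}$ of complex linear subspaces of $\mathbb{C}^l$ with no distinct $x,y\in\mathcal{A}$ satisfying $x\subset y$. Its complement is $M(\mathcal{A})=\mathbb{C}^l\setminus\bigcup_{x\in\mathcal{A}}x$. The deleted arrangement is $\mathcal{A}'=\mathcal{A}\setminus\{x_0\}$ (in $\mathbb{C}^l$). Let $\widetilde{\mathcal{A}''}=\{x_0\cap y\mid y\in\mathcal{A}'\}$; the restricted arrangement $\mathcal{A}''$ is the subspace arrangement in the vector space $x_0$ consisting of those elements of $\widetilde{\mathcal{A}''}$ not properly contained in another element of $\widetilde{\mathcal{A}''}$, and $M(\mathcal{A}'')=x_0\setminus\bigcup_{z\in\mathcal{A}''}z$. $\operatorname{codim}x_0$ is the complex codimension of $x_0$ in $\mathbb{C}^l$. *)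

theory Defs
  imports "HOL-Analysis.Analysis" "HOL-Homology.Homology"
begin

definition rcochain :: "int \<Rightarrow> 'a topology \<Rightarrow> (((nat \<Rightarrow> real) \<Rightarrow> 'a) \<Rightarrow> rat) \<Rightarrow> bool" where
  "rcochain n X c \<longleftrightarrow>
     (if n < 0 then c = (\<lambda>_. 0)
      else (\<forall>\<sigma>. \<not> singular_simplex (nat n) X \<sigma> \<longrightarrow> c \<sigma> = 0))"

definition rcobd :: "int \<Rightarrow> 'a topology \<Rightarrow> (((nat \<Rightarrow> real) \<Rightarrow> 'a) \<Rightarrow> rat)
                     \<Rightarrow> ((nat \<Rightarrow> real) \<Rightarrow> 'a) \<Rightarrow> rat" where
  "rcobd n X c = (\<lambda>\<sigma>. if 0 \<le> n \<and> singular_simplex (Suc (nat n)) X \<sigma>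
       then (\<Sum>k\<le>Suc (nat n). (-1) ^ k * c (singular_face (Suc (nat n)) k \<sigma>))
       else 0)"

definition rcocycle :: "int \<Rightarrow> 'a topology \<Rightarrow> (((nat \<Rightarrow> real) \<Rightarrow> 'a) \<Rightarrow> rat) \<Rightarrow> bool" where
  "rcocycle n X c \<longleftrightarrow> rcochain n X c \<and> rcobd n X c = (\<lambda>_. 0)"

definition rcoboundary :: "int \<Rightarrow> 'a topology \<Rightarrow> (((nat \<Rightarrow> real) \<Rightarrow> 'a) \<Rightarrow> rat) \<Rightarrow> bool" where
  "rcoboundary n X c \<longleftrightarrow> (\<exists>b. rcochain (n - 1) X b \<and> c = rcobd (n - 1) X b)"

definition hclass :: "int \<Rightarrow> 'a topology \<Rightarrow> (((nat \<Rightarrow> real) \<Rightarrow> 'a) \<Rightarrow> rat)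
                      \<Rightarrow> (((nat \<Rightarrow> real) \<Rightarrow> 'a) \<Rightarrow> rat) set" where
  "hclass n X c = {d. rcocycle n X d \<and> rcoboundary n X (\<lambda>\<sigma>. c \<sigma> - d \<sigma>)}"

definition rat_cohomology :: "int \<Rightarrow> 'a topology \<Rightarrow> (((nat \<Rightarrow> real) \<Rightarrow> 'a) \<Rightarrow> rat) set set" where
  "rat_cohomology n X = hclass n X ` Collect (rcocycle n X)"

definition crep :: "(((nat \<Rightarrow> real) \<Rightarrow> 'a) \<Rightarrow> rat) set \<Rightarrow> ((nat \<Rightarrow> real) \<Rightarrow> 'a) \<Rightarrow> rat" where
  "crep A = (SOME c. c \<in> A)"

definition czero :: "int \<Rightarrow> 'a topology \<Rightarrow> (((nat \<Rightarrow> real) \<Rightarrow> 'a) \<Rightarrow> rat) set" where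
  "czero n X = hclass n X (\<lambda>_. 0)"

definition cadd :: "int \<Rightarrow> 'a topology \<Rightarrow> (((nat \<Rightarrow> real) \<Rightarrow> 'a) \<Rightarrow> rat) set
                    \<Rightarrow> (((nat \<Rightarrow> real) \<Rightarrow> 'a) \<Rightarrow> rat) set \<Rightarrow> (((nat \<Rightarrow> real) \<Rightarrow> 'a) \<Rightarrow> rat) set" where
  "cadd n X A B = hclass n X (\<lambda>\<sigma>. crep A \<sigma> + crep B \<sigma>)"

definition cscale :: "int \<Rightarrow> 'a topology \<Rightarrow> rat
                    \<Rightarrow> (((nat \<Rightarrow> real) \<Rightarrow> 'a) \<Rightarrow> rat) set \<Rightarrow> (((nat \<Rightarrow> real) \<Rightarrow> 'a) \<Rightarrow> rat) set" where
  "cscale n X r A = hclass n X (\<lambda>\<sigma>. r * crep A \<sigma>)"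

definition cohom_linear ::
  "int \<Rightarrow> 'a topology \<Rightarrow> int \<Rightarrow> 'b topology
   \<Rightarrow> ((((nat \<Rightarrow> real) \<Rightarrow> 'a) \<Rightarrow> rat) set \<Rightarrow> (((nat \<Rightarrow> real) \<Rightarrow> 'b) \<Rightarrow> rat) set) \<Rightarrow> bool" where
  "cohom_linear n X m Y f \<longleftrightarrow>
     f \<in> rat_cohomology n X \<rightarrow> rat_cohomology m Y
   \<and> (\<forall>A\<in>rat_cohomology n X. \<forall>B\<in>rat_cohomology n X. f (cadd n X A B) = cadd m Y (f A) (f B))
   \<and> (\<forall>r. \<forall>A\<in>rat_cohomology n X. f (cscale n X r A) = cscale m Y r (f A))"

definition cohom_exact ::
  "int \<Rightarrow> 'a topology \<Rightarrow> int \<Rightarrow> 'b topology \<Rightarrow> int \<Rightarrow> 'c topology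
   \<Rightarrow> ((((nat \<Rightarrow> real) \<Rightarrow> 'a) \<Rightarrow> rat) set \<Rightarrow> (((nat \<Rightarrow> real) \<Rightarrow> 'b) \<Rightarrow> rat) set)
   \<Rightarrow> ((((nat \<Rightarrow> real) \<Rightarrow> 'b) \<Rightarrow> rat) set \<Rightarrow> (((nat \<Rightarrow> real) \<Rightarrow> 'c) \<Rightarrow> rat) set) \<Rightarrow> bool" where
  "cohom_exact n1 X1 n2 X2 n3 X3 f g \<longleftrightarrow>
     {B \<in> rat_cohomology n2 X2. g B = czero n3 X3} = f ` rat_cohomology n1 X1"

definition cohom_restrict ::
  "int \<Rightarrow> 'a topology \<Rightarrow> 'a set \<Rightarrow> (((nat \<Rightarrow> real) \<Rightarrow> 'a) \<Rightarrow> rat) set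
   \<Rightarrow> (((nat \<Rightarrow> real) \<Rightarrow> 'a) \<Rightarrow> rat) set" where
  "cohom_restrict n X S A = hclass n (subtopology X S)
     (\<lambda>\<sigma>. if 0 \<le> n \<and> singular_simplex (nat n) (subtopology X S) \<sigma> then crep A \<sigma> else 0)"

definition csubspace_arrangement :: "(complex ^ 'n) set set \<Rightarrow> bool" where
  "csubspace_arrangement \<A> \<longleftrightarrow> finite \<A> \<and> (\<forall>x\<in>\<A>. vec.subspace x)
     \<and> (\<forall>x\<in>\<A>. \<forall>y\<in>\<A>. x \<subseteq> y \<longrightarrow> x = y)"

definition arr_complement :: "(complex ^ 'n) set set \<Rightarrow> (complex ^ 'n) set" where
  "arr_complement \<A> = UNIV - \<Union>\<A>"

definition deleted_arr :: "(complex ^ 'n) set set \<Rightarrow> (complex ^ 'n) set \<Rightarrow> (complex ^ 'n) set set" where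
  "deleted_arr \<A> x0 = \<A> - {x0}"

definition restricted_arr :: "(complex ^ 'n) set set \<Rightarrow> (complex ^ 'n) set \<Rightarrow> (complex ^ 'n) set set" where
  "restricted_arr \<A> x0 =
     (let T = (\<lambda>y. x0 \<inter> y) ` deleted_arr \<A> x0 in {z \<in> T. \<not> (\<exists>w\<in>T. z \<subset> w)})"

definition restricted_complement :: "(complex ^ 'n) set set \<Rightarrow> (complex ^ 'n) set \<Rightarrow> (complex ^ 'n) set" where
  "restricted_complement \<A> x0 = x0 - \<Union>(restricted_arr \<A> x0)"

definition ccodim :: "(complex ^ 'n) set \<Rightarrow> nat" where
  "ccodim x = CARD('n) - vec.dim x"

end

theory Submission
  imports Defs
begin

text \<open>Write \<open>U = M(\<A>')\<close>, an open set, and \<open>Z = U \<inter> x0\<close>; then \<open>M(\<A>) = U - x0\<close> and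
  \<open>M(\<A>'') = Z\<close>. The sequence is the rational dual of the integral homology sequence of the
  pair \<open>(U, U - x0)\<close>, in which \<open>H\<^sub>k(U, U - x0)\<close> is replaced by \<open>H\<^sub>k\<^sub>-\<^sub>2\<^sub>c(Z)\<close> with \<open>c = codim x0\<close>.
  Dualising is exact because \<open>\<rat>\<close> is an injective abelian group, and for the same reason
  rational cohomology is the dual of integral homology. For the Thom isomorphism
  \<open>H\<^sub>k(U, U - x0) \<cong> H\<^sub>k\<^sub>-\<^sub>2\<^sub>c(Z)\<close> no tubular neighbourhood is needed: with \<open>N\<close> the orthogonal
  complement of \<open>x0\<close>, the set \<open>Z + N\<close> is open and agrees with \<open>U\<close> near \<open>Z\<close>, so excision
  replaces \<open>U\<close> by \<open>Z \<times> N\<close>, from which the directions of \<open>N\<close> are removed one at a time.\<close>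

subsection \<open>Extending homomorphisms into the rationals\<close>

text \<open>All geometry takes place in integral singular homology, with its excision, homotopy and
  exactness axioms; cochains enter only through their pairing with cycles. As \<open>g\<close> and
  \<open>h\<close> are existentially quantified, an abstract isomorphism between the homology of (U,
  U - x0) and that of Z suffices to transport the exact sequence, with no naturality and no
  orientation class. Only the restriction maps, which the statement fixes, must be recognised as
  transposes of inclusions. The number d = 2c - 1 combines the real codimension 2c of
  \<open>x0\<close>, one degree for each real direction of N, with the boundary map, which lowers
  the degree by one. The set Z + N is the preimage of U under the orthogonal projection onto
  \<open>x0\<close>, hence open. Homology and cohomology both vanish in negative degrees, which lets
  the sequence run over all integers \<open>q\<close>.\<close>

definition rat_dual :: "('a, 'b) monoid_scheme \<Rightarrow> ('a \<Rightarrow> rat) set" where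
  "rat_dual G = {f \<in> extensional (carrier G).
     \<forall>x\<in>carrier G. \<forall>y\<in>carrier G. f (x \<otimes>\<^bsub>G\<^esub> y) = f x + f y}"

lemma rat_dual_mult:
  "f \<in> rat_dual G \<Longrightarrow> x \<in> carrier G \<Longrightarrow> y \<in> carrier G \<Longrightarrow> f (x \<otimes>\<^bsub>G\<^esub> y) = f x + f y"
  by (simp add: rat_dual_def)

lemma rat_dual_eqI:
  assumes "f \<in> rat_dual G" "g \<in> rat_dual G" "\<And>x. x \<in> carrier G \<Longrightarrow> f x = g x"
  shows "f = g"
  using assms by (auto simp: rat_dual_def intro: extensionalityI)

lemma rat_dual_restrictI:
  assumes "\<And>x y. x \<in> carrier G \<Longrightarrow> y \<in> carrier G \<Longrightarrow> x \<otimes>\<^bsub>G\<^esub> y \<in> carrier G"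
    and "\<And>x y. x \<in> carrier G \<Longrightarrow> y \<in> carrier G \<Longrightarrow> f (x \<otimes>\<^bsub>G\<^esub> y) = f x + f y"
  shows "restrict f (carrier G) \<in> rat_dual G"
  using assms by (simp add: rat_dual_def)

lemma rat_dual_one:
  assumes "group G" "f \<in> rat_dual G" shows "f \<one>\<^bsub>G\<^esub> = 0"
  using rat_dual_mult[of f G "\<one>\<^bsub>G\<^esub>" "\<one>\<^bsub>G\<^esub>"] assms
  by (simp add: group.is_monoid)

lemma rat_dual_inv:
  assumes "group G" "f \<in> rat_dual G" "x \<in> carrier G" shows "f (inv\<^bsub>G\<^esub> x) = - f x"
proof -
  have "f x + f (inv\<^bsub>G\<^esub> x) = 0"
    using rat_dual_mult[of f G x "inv\<^bsub>G\<^esub> x"] rat_dual_one[of G f] assms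
    by (simp add: group.r_inv)
  then show ?thesis by simp
qed

lemma rat_dual_comp:
  assumes "group G" "\<theta> \<in> hom G L" "f \<in> rat_dual L"
  shows "(\<lambda>x\<in>carrier G. f (\<theta> x)) \<in> rat_dual G"
  using assms(2,3) group.is_monoid[OF assms(1)]
  by (intro rat_dual_restrictI) (auto simp: hom_def rat_dual_mult monoid.m_closed Pi_iff)

text \<open>Partial homomorphisms are handled as their graphs: subgroups of $L \times \mathbb{Q}$
  which are single valued at the neutral element.\<close>

definition partial_rat_hom :: "('a, 'b) monoid_scheme \<Rightarrow> ('a \<times> rat) set \<Rightarrow> bool" where
  "partial_rat_hom L R \<longleftrightarrow> R \<noteq> {} \<and> R \<subseteq> carrier L \<times> UNIV
     \<and> (\<forall>x r y s. (x, r) \<in> R \<longrightarrow> (y, s) \<in> R \<longrightarrow> (x \<otimes>\<^bsub>L\<^esub> inv\<^bsub>L\<^esub> y, r - s) \<in> R)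
     \<and> (\<forall>r. (\<one>\<^bsub>L\<^esub>, r) \<in> R \<longrightarrow> r = 0)"

context comm_group
begin

lemma partial_rat_hom_carrier: "partial_rat_hom G R \<Longrightarrow> (x, r) \<in> R \<Longrightarrow> x \<in> carrier G"
  by (auto simp: partial_rat_hom_def)

lemma partial_rat_hom_diff:
  "partial_rat_hom G R \<Longrightarrow> (x, r) \<in> R \<Longrightarrow> (y, s) \<in> R \<Longrightarrow> (x \<otimes> inv y, r - s) \<in> R"
  by (auto simp: partial_rat_hom_def)

lemma partial_rat_hom_one:
  assumes "partial_rat_hom G R" shows "(\<one>, 0) \<in> R"
proof -
  obtain x r where x: "(x, r) \<in> R"
    using assms by (auto simp: partial_rat_hom_def)
  then have "x \<in> carrier G" using assms by (simp add: partial_rat_hom_carrier)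
  then show ?thesis using partial_rat_hom_diff[OF assms x x] by simp
qed

lemma partial_rat_hom_inv:
  assumes "partial_rat_hom G R" "(x, r) \<in> R" shows "(inv x, - r) \<in> R"
  using partial_rat_hom_diff[OF assms(1) partial_rat_hom_one[OF assms(1)] assms(2)]
    partial_rat_hom_carrier[OF assms] by simp

lemma partial_rat_hom_mult:
  assumes "partial_rat_hom G R" "(x, r) \<in> R" "(y, s) \<in> R" shows "(x \<otimes> y, r + s) \<in> R"
  using partial_rat_hom_diff[OF assms(1,2) partial_rat_hom_inv[OF assms(1,3)]]
    partial_rat_hom_carrier[OF assms(1,3)] by simp

text \<open>The difference of two values at one point is a value at the neutral element, so
  single-valuedness there spreads to every point.\<close>

lemma partial_rat_hom_unique:
  assumes "partial_rat_hom G R" "(x, r) \<in> R" "(x, s) \<in> R" shows "r = s"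
proof -
  have "(\<one>, r - s) \<in> R"
    using partial_rat_hom_diff[OF assms] partial_rat_hom_carrier[OF assms(1,2)] by simp
  then show ?thesis using assms(1) by (auto simp: partial_rat_hom_def)
qed

lemma partial_rat_hom_int_pow:
  assumes "partial_rat_hom G R" "(x, r) \<in> R" shows "(x [^] (n::int), of_int n * r) \<in> R"
proof -
  have nat: "(x [^] (k::nat), of_nat k * r) \<in> R" for k
  proof (induction k)
    case 0 then show ?case using partial_rat_hom_one[OF assms(1)] by simp
  next
    case (Suc k)
    from partial_rat_hom_mult[OF assms(1) Suc assms(2)]
    show ?case by (simp add: algebra_simps)
  qed
  show ?thesis
  proof (cases "0 \<le> n")
    case True
    then obtain k where "n = int k" using zero_le_imp_eq_int by blast
    then show ?thesis using nat[of k] by (simp add: int_pow_int)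
  next
    case False
    then obtain k where n: "n = - int k" by (metis int_cases2 of_nat_0_le_iff)
    then show ?thesis
      using partial_rat_hom_inv[OF assms(1) nat[of k]] partial_rat_hom_carrier[OF assms]
      by (simp add: int_pow_neg int_pow_int)
  qed
qed

text \<open>Divisibility of the rationals is what allows one more element \<open>y\<close> to be
  adjoined.\<close>

lemma partial_rat_hom_extend:
  assumes R: "partial_rat_hom G R" and y: "y \<in> carrier G"
  obtains q where "partial_rat_hom G {(x \<otimes> y [^] n, r + of_int n * q) | x r n::int. (x, r) \<in> R}"
proof -
  obtain q where q: "\<And>(n::int) r. (y [^] n, r) \<in> R \<Longrightarrow> r = of_int n * q"
  proof (cases "\<exists>(n::int) r. n \<noteq> 0 \<and> (y [^] n, r) \<in> R")
    case True
    then obtain m :: int and s where m: "m \<noteq> 0" "(y [^] m, s) \<in> R" by blast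
    have "r = of_int n * (s / of_int m)" if "(y [^] n, r) \<in> R" for n :: int and r
    proof -
      \<comment> \<open>Two prescribed values are compared at the common power
        \<open>y [^] (n * m)\<close>.\<close>
      have "(y [^] (n * m), of_int m * r) \<in> R"
        using partial_rat_hom_int_pow[OF R that, of m] y by (simp add: int_pow_pow)
      moreover have "(y [^] (n * m), of_int n * s) \<in> R"
        using partial_rat_hom_int_pow[OF R m(2), of n] y by (simp add: int_pow_pow mult.commute)
      ultimately have "of_int m * r = of_int n * s"
        by (rule partial_rat_hom_unique[OF R])
      then show ?thesis using m(1) by (simp add: field_simps)
    qed
    then show ?thesis by (rule that)
  next
    case False
    have "r = of_int n * 0" if "(y [^] n, r) \<in> R" for n :: int and r
    proof -
      have "n = 0" using False that by blast
      then show ?thesis using that R by (auto simp: partial_rat_hom_def)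
    qed
    then show ?thesis by (rule that)
  qed
  have "partial_rat_hom G {(x \<otimes> y [^] n, r + of_int n * q) | x r n::int. (x, r) \<in> R}"
    (is "partial_rat_hom G ?R'")
    unfolding partial_rat_hom_def
  proof (intro conjI allI impI)
    show "?R' \<noteq> {}" using partial_rat_hom_one[OF R] by blast
    show "?R' \<subseteq> carrier G \<times> UNIV"
      using y partial_rat_hom_carrier[OF R] by auto
    fix u a v b assume "(u, a) \<in> ?R'" "(v, b) \<in> ?R'"
    then obtain x r z s and n k :: int where
      1: "(x, r) \<in> R" "u = x \<otimes> y [^] n" "a = r + of_int n * q" and
      2: "(z, s) \<in> R" "v = z \<otimes> y [^] k" "b = s + of_int k * q" by blast
    have [simp]: "x \<in> carrier G" "z \<in> carrier G"
      using 1 2 partial_rat_hom_carrier[OF R] by auto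
    have "u \<otimes> inv v = (x \<otimes> inv z) \<otimes> y [^] (n - k)"
      using y 1 2 by (simp add: inv_mult int_pow_diff m_ac)
    moreover have "a - b = (r - s) + of_int (n - k) * q"
      using 1 2 by (simp add: algebra_simps)
    ultimately show "(u \<otimes> inv v, a - b) \<in> ?R'"
      using partial_rat_hom_diff[OF R 1(1) 2(1)] by blast
  next
    fix a assume "(\<one>, a) \<in> ?R'"
    then obtain x r and n :: int where
      1: "(x, r) \<in> R" "\<one> = x \<otimes> y [^] n" "a = r + of_int n * q" by blast
    have x: "x \<in> carrier G" using 1 partial_rat_hom_carrier[OF R] by auto
    \<comment> \<open>The relation puts a power of \<open>y\<close> into the old domain, where
      \<open>q\<close> was chosen to agree with the old value.\<close>
    have "inv x = y [^] n"
      using inv_equality[of "y [^] n" x] 1(2) x y by (simp add: m_comm)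
    then have "(y [^] n, - r) \<in> R" using partial_rat_hom_inv[OF R 1(1)] by simp
    then show "a = 0" using q 1(3) by fastforce
  qed
  then show thesis by (rule that)
qed

text \<open>This is the injectivity of \<open>\<rat>\<close> as an abelian group.\<close>

proposition rat_dual_factor:
  assumes "group H" and \<theta>: "\<theta> \<in> hom H G" and f: "f \<in> rat_dual H"
    and ker: "\<And>x. x \<in> carrier H \<Longrightarrow> \<theta> x = \<one> \<Longrightarrow> f x = 0"
  obtains f' where "f' \<in> rat_dual G" "\<And>x. x \<in> carrier H \<Longrightarrow> f' (\<theta> x) = f x"
proof -
  interpret H: group H by fact
  interpret \<theta>: group_hom H G \<theta>
    by unfold_locales (rule \<theta>)
  \<comment> \<open>The graph of the map induced on the image of \<open>\<theta>\<close>;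
    \<open>ker\<close> gives its single-valuedness at the neutral element.\<close>
  define R0 where "R0 = (\<lambda>x. (\<theta> x, f x)) ` carrier H"
  have R0: "partial_rat_hom G R0"
    unfolding partial_rat_hom_def
  proof (intro conjI allI impI)
    show "R0 \<noteq> {}" "R0 \<subseteq> carrier G \<times> UNIV"
      by (auto simp: R0_def)
    fix x r y s assume "(x, r) \<in> R0" "(y, s) \<in> R0"
    then obtain a b where ab: "a \<in> carrier H" "b \<in> carrier H"
      "x = \<theta> a" "y = \<theta> b" "r = f a" "s = f b" by (auto simp: R0_def)
    then have "(x \<otimes> inv y, r - s) = (\<theta> (a \<otimes>\<^bsub>H\<^esub> inv\<^bsub>H\<^esub> b), f (a \<otimes>\<^bsub>H\<^esub> inv\<^bsub>H\<^esub> b))"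
      using f by (simp add: rat_dual_mult rat_dual_inv \<open>group H\<close>)
    moreover have "\<dots> \<in> R0"
      unfolding R0_def using ab(1,2) by (intro imageI) simp
    ultimately show "(x \<otimes> inv y, r - s) \<in> R0"
      by (simp only:)
  qed (use ker in \<open>auto simp: R0_def\<close>)
  define \<A> where "\<A> = {R. partial_rat_hom G R \<and> R0 \<subseteq> R}"
  have "\<exists>M\<in>\<A>. \<forall>X\<in>\<A>. M \<subseteq> X \<longrightarrow> X = M"
  proof (rule subset_Zorn_nonempty)
    show "\<A> \<noteq> {}" using R0 by (auto simp: \<A>_def)
    fix \<C> assume ne: "\<C> \<noteq> {}" and ch: "subset.chain \<A> \<C>"
    have P: "partial_rat_hom G R" "R0 \<subseteq> R" if "R \<in> \<C>" for R
      using that ch by (auto simp: \<A>_def subset.chain_def)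
    have "partial_rat_hom G (\<Union>\<C>)"
      unfolding partial_rat_hom_def
    proof (intro conjI allI impI)
      obtain R where "R \<in> \<C>" using ne by blast
      then show "\<Union>\<C> \<noteq> {}" using partial_rat_hom_one[OF P(1)[of R]] by blast
      show "\<Union>\<C> \<subseteq> carrier G \<times> UNIV"
      proof (rule subrelI)
        fix x r assume "(x, r) \<in> \<Union>\<C>"
        then obtain R where "R \<in> \<C>" "(x, r) \<in> R" by blast
        then show "(x, r) \<in> carrier G \<times> UNIV" by (simp add: partial_rat_hom_carrier[OF P(1)])
      qed
      fix x r y s assume "(x, r) \<in> \<Union>\<C>" "(y, s) \<in> \<Union>\<C>"
      then obtain R S where RS: "R \<in> \<C>" "S \<in> \<C>" "(x, r) \<in> R" "(y, s) \<in> S" by blast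
      then have "R \<subseteq> S \<or> S \<subseteq> R" using ch by (auto simp: subset.chain_def)
      then obtain T where "T \<in> \<C>" "(x, r) \<in> T" "(y, s) \<in> T" using RS by blast
      then show "(x \<otimes> inv y, r - s) \<in> \<Union>\<C>"
        by (intro UnionI[of T] partial_rat_hom_diff P(1))
    next
      fix r assume "(\<one>, r) \<in> \<Union>\<C>"
      then obtain T where "T \<in> \<C>" "(\<one>, r) \<in> T" by blast
      then show "r = 0"
        by (intro partial_rat_hom_unique[OF P(1) _ partial_rat_hom_one[OF P(1)]])
    qed
    moreover have "R0 \<subseteq> \<Union>\<C>" using ne P(2) by blast
    ultimately show "\<Union>\<C> \<in> \<A>" by (simp add: \<A>_def)
  qed
  then obtain M where M: "partial_rat_hom G M" "R0 \<subseteq> M"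
    and max: "\<And>X. partial_rat_hom G X \<Longrightarrow> M \<subseteq> X \<Longrightarrow> X = M"
    unfolding \<A>_def by auto
  \<comment> \<open>A maximal relation is defined everywhere, since adjoining \<open>y\<close>
    cannot enlarge it.\<close>
  have total: "\<exists>r. (y, r) \<in> M" if y: "y \<in> carrier G" for y
  proof -
    obtain q where q: "partial_rat_hom G {(x \<otimes> y [^] n, r + of_int n * q) | x r n::int. (x, r) \<in> M}"
      (is "partial_rat_hom G ?M'") using partial_rat_hom_extend[OF M(1) y] .
    have mem: "(x \<otimes> y [^] n, r + of_int n * q) \<in> ?M'" if "(x, r) \<in> M" for x r and n :: int
      using that by blast
    have "M \<subseteq> ?M'"
    proof (rule subrelI)
      fix x r assume xr: "(x, r) \<in> M"
      then show "(x, r) \<in> ?M'"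
        using mem[OF xr, of 0] partial_rat_hom_carrier[OF M(1) xr] by (simp only: int_pow_0 r_one) simp
    qed
    with q have "?M' = M" by (rule max)
    moreover have "(y, q) \<in> ?M'"
      using mem[OF partial_rat_hom_one[OF M(1)], of 1] y by (simp only: int_pow_1 l_one) simp
    ultimately have "(y, q) \<in> M" by (simp only:)
    then show ?thesis ..
  qed
  define f' where "f' = (\<lambda>y\<in>carrier G. THE r. (y, r) \<in> M)"
  have f'_eq: "f' y = r" if "(y, r) \<in> M" for y r
  proof -
    have "(THE r. (y, r) \<in> M) = r"
      using that by (rule the_equality) (rule partial_rat_hom_unique[OF M(1) _ that])
    then show ?thesis using partial_rat_hom_carrier[OF M(1) that] by (simp add: f'_def)
  qed
  show thesis
  proof
    show "f' \<in> rat_dual G"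
      unfolding rat_dual_def
    proof (intro CollectI conjI ballI)
      show "f' \<in> extensional (carrier G)" by (simp add: f'_def)
      fix x y assume "x \<in> carrier G" "y \<in> carrier G"
      then obtain r s where "(x, r) \<in> M" "(y, s) \<in> M" using total by blast
      then show "f' (x \<otimes> y) = f' x + f' y"
        using partial_rat_hom_mult[OF M(1)] by (simp add: f'_eq)
    qed
    show "f' (\<theta> x) = f x" if "x \<in> carrier H" for x
      using that M(2) by (intro f'_eq) (auto simp: R0_def)
  qed
qed

end

subsection \<open>Evaluating cochains on chains\<close>

definition chain_eval :: "('s \<Rightarrow> rat) \<Rightarrow> ('s \<Rightarrow>\<^sub>0 int) \<Rightarrow> rat" where
  "chain_eval c z = (\<Sum>\<sigma>\<in>Poly_Mapping.keys z. of_int (Poly_Mapping.lookup z \<sigma>) * c \<sigma>)"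

lemma chain_eval_superset:
  assumes "finite S" "Poly_Mapping.keys z \<subseteq> S"
  shows "chain_eval c z = (\<Sum>\<sigma>\<in>S. of_int (Poly_Mapping.lookup z \<sigma>) * c \<sigma>)"
  unfolding chain_eval_def
  by (rule sum.mono_neutral_left) (use assms in \<open>auto simp: in_keys_iff\<close>)

lemma chain_eval_0 [simp]: "chain_eval c 0 = 0"
  by (simp add: chain_eval_def)

lemma chain_eval_frag_of [simp]: "chain_eval c (frag_of \<sigma>) = c \<sigma>"
  by (simp add: chain_eval_def)

lemma chain_eval_add: "chain_eval c (x + y) = chain_eval c x + chain_eval c y"
  using keys_add[of x y]
  by (simp add: chain_eval_superset[of "Poly_Mapping.keys x \<union> Poly_Mapping.keys y"]
      lookup_add ring_distribs sum.distrib)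

lemma chain_eval_cmul: "chain_eval c (frag_cmul k x) = of_int k * chain_eval c x"
  using keys_cmul[of k x]
  by (simp add: chain_eval_superset[of "Poly_Mapping.keys x"] sum_distrib_left mult.assoc)

lemma chain_eval_diff: "chain_eval c (x - y) = chain_eval c x - chain_eval c y"
  using chain_eval_add[of c "x - y" y] by simp

lemma chain_eval_sum: "chain_eval c (sum f I) = (\<Sum>i\<in>I. chain_eval c (f i))"
  by (induction I rule: infinite_finite_induct) (simp_all add: chain_eval_add)

lemma chain_eval_frag_extend:
  "chain_eval c (frag_extend f z) = chain_eval (\<lambda>\<sigma>. chain_eval c (f \<sigma>)) z"
  by (simp add: frag_extend_def chain_eval_sum chain_eval_cmul chain_eval_def[of _ z])

lemma chain_eval_cong:
  "(\<And>\<sigma>. \<sigma> \<in> Poly_Mapping.keys z \<Longrightarrow> c \<sigma> = d \<sigma>) \<Longrightarrow> chain_eval c z = chain_eval d z"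
  by (simp add: chain_eval_def)

lemma chain_eval_zero_fun [simp]: "chain_eval (\<lambda>_. 0) z = 0"
  by (simp add: chain_eval_def)

lemma chain_eval_add_fun: "chain_eval (\<lambda>\<sigma>. c \<sigma> + d \<sigma>) z = chain_eval c z + chain_eval d z"
  by (simp add: chain_eval_def ring_distribs sum.distrib)

lemma chain_eval_diff_fun: "chain_eval (\<lambda>\<sigma>. c \<sigma> - d \<sigma>) z = chain_eval c z - chain_eval d z"
  by (simp add: chain_eval_def ring_distribs sum_subtractf)

lemma chain_eval_scale_fun: "chain_eval (\<lambda>\<sigma>. r * c \<sigma>) z = r * chain_eval c z"
  by (simp add: chain_eval_def sum_distrib_left mult.left_commute)

text \<open>The coboundary is the adjoint of the boundary. The chain has to lie in \<open>X\<close>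
  because \<open>rcobd\<close> is cut off to 0 on all other maps.\<close>

lemma chain_eval_rcobd:
  assumes "singular_chain (Suc n) X z"
  shows "chain_eval (rcobd (int n) X c) z = chain_eval c (chain_boundary (Suc n) z)"
proof -
  have "chain_eval c (chain_boundary (Suc n) z) =
    chain_eval (\<lambda>\<sigma>. \<Sum>k\<le>Suc n. (-1) ^ k * c (singular_face (Suc n) k \<sigma>)) z"
    by (simp add: chain_boundary_def chain_eval_frag_extend chain_eval_sum chain_eval_cmul
             del: sum.atMost_Suc)
  also have "\<dots> = chain_eval (rcobd (int n) X c) z"
    using assms by (intro chain_eval_cong) (auto simp: rcobd_def singular_chain_def)
  finally show ?thesis ..
qed

lemma rcobd_eq_chain_eval:
  "singular_simplex (Suc n) X \<sigma> \<Longrightarrow>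
    rcobd (int n) X c \<sigma> = chain_eval c (chain_boundary (Suc n) (frag_of \<sigma>))"
  by (metis chain_eval_frag_of chain_eval_rcobd singular_chain_of)

text \<open>Chains form the free abelian group on the simplices, so a functional is recovered from
  its values on generators.\<close>

lemma rat_dual_chain_group:
  assumes "f \<in> rat_dual (chain_group n X)"
  obtains c where "rcochain (int n) X c" "\<And>z. singular_chain n X z \<Longrightarrow> chain_eval c z = f z"
proof -
  define c where "c = (\<lambda>\<sigma>. if singular_simplex n X \<sigma> then f (frag_of \<sigma>) else 0)"
  have add: "f (x + y) = f x + f y" if "singular_chain n X x" "singular_chain n X y" for x y
    using rat_dual_mult[OF assms, of x y] that by simp
  show thesis
  proof
    show "rcochain (int n) X c" by (simp add: rcochain_def c_def)
    fix z assume "singular_chain n X z"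
    \<comment> \<open>Membership in the chain group is part of the induction claim because
      \<open>f\<close> is additive only there.\<close>
    then have "singular_chain n X z \<and> chain_eval c z = f z"
      unfolding singular_chain_def[of n X z]
    proof (induction z rule: frag_induction)
      case zero
      then show ?case using add[of 0 0] by simp
    next
      case (one \<sigma>)
      then show ?case by (simp add: c_def)
    next
      case (diff a b)
      then have ab: "singular_chain n X a" "singular_chain n X b" by (auto simp: singular_chain_def)
      then have "singular_chain n X (a - b)" by (rule singular_chain_diff)
      with diff ab add[of "a - b" b] show ?case by (simp add: singular_chain_def chain_eval_diff)
    qed
    then show "chain_eval c z = f z" ..
  qed
qed

lemma chain_eval_in_rat_dual: "restrict (chain_eval c) (singular_chain_set n X) \<in> rat_dual (chain_group n X)"
  by (simp add: rat_dual_def chain_eval_add singular_chain_add)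

lemma rcobd_zero [simp]: "rcobd n X (\<lambda>_. 0) = (\<lambda>_. 0)"
  by (simp add: rcobd_def fun_eq_iff)

text \<open>A cochain vanishing on cycles factors through the boundary map, and injectivity of the
  rationals extends the factor from boundaries to all chains one degree lower, which gives a
  primitive. This is where the Ext term of the universal coefficient theorem disappears.\<close>

lemma rcoboundary_of_vanishing:
  assumes c: "rcochain (int n) X c"
    and van: "\<And>z. singular_relcycle n X {} z \<Longrightarrow> chain_eval c z = 0"
  shows "rcoboundary (int n) X c"
proof (cases n)
  case 0
  \<comment> \<open>Every 0-simplex is a cycle, and the only 0-coboundary is 0.\<close>
  have "c \<sigma> = 0" for \<sigma>
    using van[of "frag_of \<sigma>"] c 0
    by (cases "singular_simplex 0 X \<sigma>")
       (simp_all add: singular_cycle singular_chain_of chain_boundary_of rcochain_def)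
  then have "c = rcobd (int n - 1) X (\<lambda>_. 0)" by auto
  then show ?thesis using 0 by (auto simp: rcoboundary_def rcochain_def intro!: exI[of _ "\<lambda>_. 0"])
next
  case (Suc m)
  define f where "f = restrict (chain_eval c) (singular_chain_set n X)"
  have f: "f \<in> rat_dual (chain_group n X)"
    unfolding f_def by (rule chain_eval_in_rat_dual)
  have hom: "chain_boundary n \<in> hom (chain_group n X) (chain_group m X)"
    using Suc by (auto simp: hom_def chain_boundary_add singular_chain_boundary_alt)
  obtain f' where f': "f' \<in> rat_dual (chain_group m X)"
      "\<And>x. x \<in> carrier (chain_group n X) \<Longrightarrow> f' (chain_boundary n x) = f x"
  proof (rule comm_group.rat_dual_factor[OF abelian_chain_group group_chain_group hom f])
    fix x assume "x \<in> carrier (chain_group n X)"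
      "chain_boundary n x = \<one>\<^bsub>chain_group m X\<^esub>"
    then show "f x = 0" using van[of x] by (simp add: f_def singular_cycle)
  qed (rule that)
  obtain b where b: "rcochain (int m) X b"
    "\<And>z. singular_chain m X z \<Longrightarrow> chain_eval b z = f' z"
    using rat_dual_chain_group[OF f'(1)] by blast
  have "c \<sigma> = rcobd (int m) X b \<sigma>" for \<sigma>
  proof (cases "singular_simplex n X \<sigma>")
    case True
    then have \<sigma>: "singular_chain n X (frag_of \<sigma>)" by (simp add: singular_chain_of)
    have "rcobd (int m) X b \<sigma> = f' (chain_boundary n (frag_of \<sigma>))"
      using True \<sigma> Suc by (simp add: rcobd_eq_chain_eval b(2) singular_chain_boundary_alt)
    also have "\<dots> = c \<sigma>" using f'(2)[of "frag_of \<sigma>"] \<sigma> by (simp add: f_def)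
    finally show ?thesis ..
  next
    case False
    then show ?thesis using c Suc by (simp add: rcochain_def rcobd_def nat_add_distrib)
  qed
  then show ?thesis
    using b(1) Suc by (auto simp: rcoboundary_def fun_eq_iff)
qed

subsection \<open>Cohomology classes\<close>

lemma rcobd_add: "rcobd n X (\<lambda>\<sigma>. c \<sigma> + d \<sigma>) = (\<lambda>\<sigma>. rcobd n X c \<sigma> + rcobd n X d \<sigma>)"
  by (auto simp: rcobd_def ring_distribs sum.distrib)

lemma rcobd_diff: "rcobd n X (\<lambda>\<sigma>. c \<sigma> - d \<sigma>) = (\<lambda>\<sigma>. rcobd n X c \<sigma> - rcobd n X d \<sigma>)"
  by (auto simp: rcobd_def ring_distribs sum_subtractf)

lemma rcobd_scale: "rcobd n X (\<lambda>\<sigma>. r * c \<sigma>) = (\<lambda>\<sigma>. r * rcobd n X c \<sigma>)"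
  by (auto simp: rcobd_def sum_distrib_left ring_distribs mult.left_commute)

lemma rcocycle_zero: "rcocycle n X (\<lambda>_. 0)"
  by (simp add: rcocycle_def rcochain_def)

lemma rcocycle_add: "rcocycle n X c \<Longrightarrow> rcocycle n X d \<Longrightarrow> rcocycle n X (\<lambda>\<sigma>. c \<sigma> + d \<sigma>)"
  by (auto simp: rcocycle_def rcochain_def rcobd_add split: if_splits)

lemma rcocycle_scale: "rcocycle n X c \<Longrightarrow> rcocycle n X (\<lambda>\<sigma>. r * c \<sigma>)"
  by (auto simp: rcocycle_def rcochain_def rcobd_scale split: if_splits)

lemma rcochain_diff: "rcochain n X c \<Longrightarrow> rcochain n X d \<Longrightarrow> rcochain n X (\<lambda>\<sigma>. c \<sigma> - d \<sigma>)"
  by (auto simp: rcochain_def split: if_splits)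

lemma rcoboundary_diff:
  assumes "rcoboundary n X c" "rcoboundary n X d"
  shows "rcoboundary n X (\<lambda>\<sigma>. c \<sigma> - d \<sigma>)"
proof -
  obtain a b where "rcochain (n - 1) X a" "c = rcobd (n - 1) X a"
    "rcochain (n - 1) X b" "d = rcobd (n - 1) X b"
    using assms unfolding rcoboundary_def by blast
  then have "rcochain (n - 1) X (\<lambda>\<sigma>. a \<sigma> - b \<sigma>) \<and>
      (\<lambda>\<sigma>. c \<sigma> - d \<sigma>) = rcobd (n - 1) X (\<lambda>\<sigma>. a \<sigma> - b \<sigma>)"
    by (simp add: rcochain_diff rcobd_diff)
  then show ?thesis unfolding rcoboundary_def by blast
qed

lemma rcoboundary_zero: "rcoboundary n X (\<lambda>_. 0)"
  unfolding rcoboundary_def by (rule exI[of _ "\<lambda>_. 0"]) (simp add: rcochain_def)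

lemma hclass_self: "rcocycle n X c \<Longrightarrow> c \<in> hclass n X c"
  by (simp add: hclass_def rcoboundary_zero)

lemma hclass_eqI:
  assumes "rcoboundary n X (\<lambda>\<sigma>. c \<sigma> - d \<sigma>)"
  shows "hclass n X c = hclass n X d"
proof -
  have "rcoboundary n X (\<lambda>\<sigma>. c \<sigma> - e \<sigma>) \<longleftrightarrow> rcoboundary n X (\<lambda>\<sigma>. d \<sigma> - e \<sigma>)" for e
  proof
    assume "rcoboundary n X (\<lambda>\<sigma>. c \<sigma> - e \<sigma>)"
    from rcoboundary_diff[OF this assms] show "rcoboundary n X (\<lambda>\<sigma>. d \<sigma> - e \<sigma>)" by simp
  next
    assume de: "rcoboundary n X (\<lambda>\<sigma>. d \<sigma> - e \<sigma>)"
    have "rcoboundary n X (\<lambda>\<sigma>. 0 - (c \<sigma> - d \<sigma>))"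
      by (rule rcoboundary_diff[OF rcoboundary_zero assms])
    from rcoboundary_diff[OF de this] show "rcoboundary n X (\<lambda>\<sigma>. c \<sigma> - e \<sigma>)" by simp
  qed
  then show ?thesis by (simp add: hclass_def)
qed

lemma hclass_in_cohomology: "rcocycle n X c \<Longrightarrow> hclass n X c \<in> rat_cohomology n X"
  by (simp add: rat_cohomology_def)

text \<open>Operations on classes are defined through chosen representatives; these two facts make
  the choice harmless.\<close>

lemma
  assumes "A \<in> rat_cohomology n X"
  shows rcocycle_crep: "rcocycle n X (crep A)" and hclass_crep: "hclass n X (crep A) = A"
proof -
  obtain c where c: "rcocycle n X c" "A = hclass n X c"
    using assms by (auto simp: rat_cohomology_def)
  have "crep A \<in> A"
    unfolding crep_def by (rule someI[of _ c]) (simp add: c hclass_self)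
  then have "crep A \<in> hclass n X c" by (simp only: c(2))
  then have *: "rcocycle n X (crep A)" "rcoboundary n X (\<lambda>\<sigma>. c \<sigma> - crep A \<sigma>)"
    by (simp_all add: hclass_def)
  from *(1) show "rcocycle n X (crep A)" .
  from hclass_eqI[OF *(2)] show "hclass n X (crep A) = A" unfolding c(2)[symmetric] ..
qed

lemma chain_eval_cohomologous:
  assumes "rcoboundary (int n) X (\<lambda>\<sigma>. c \<sigma> - d \<sigma>)" "singular_relcycle n X {} z"
  shows "chain_eval c z = chain_eval d z"
proof -
  obtain b where b: "rcochain (int n - 1) X b" "(\<lambda>\<sigma>. c \<sigma> - d \<sigma>) = rcobd (int n - 1) X b"
    using assms(1) by (auto simp: rcoboundary_def)
  have "chain_eval (rcobd (int n - 1) X b) z = 0"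
  proof (cases n)
    case 0
    then have "rcobd (int n - 1) X b = (\<lambda>_. 0)" by (simp add: rcobd_def)
    then show ?thesis by simp
  next
    case (Suc m)
    then show ?thesis using assms(2) chain_eval_rcobd[of m X z b] by (simp add: singular_cycle)
  qed
  then have "chain_eval (\<lambda>\<sigma>. c \<sigma> - d \<sigma>) z = 0" using b(2) by simp
  then show ?thesis by (simp add: chain_eval_diff_fun)
qed

lemma chain_eval_homologous:
  assumes "rcocycle (int n) X c" "homologous_rel n X {} z w"
  shows "chain_eval c z = chain_eval c w"
proof -
  obtain e where e: "singular_chain (Suc n) X e" "chain_boundary (Suc n) e = z - w"
    using assms(2) by (auto simp: homologous_rel_def singular_boundary)
  have "chain_eval c (z - w) = chain_eval (rcobd (int n) X c) e"
    using e by (simp add: chain_eval_rcobd)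
  also have "\<dots> = 0" using assms(1) by (simp add: rcocycle_def)
  finally show ?thesis by (simp add: chain_eval_diff)
qed

subsection \<open>The universal coefficient theorem over the rationals\<close>

text \<open>Representatives are chosen on both sides, so that this is a function of classes from the
  outset and independence of the choices becomes a lemma. Restricting to the carrier matches the
  extensionality in \<open>rat_dual\<close>.\<close>

definition kronecker ::
  "int \<Rightarrow> 'a topology \<Rightarrow> (((nat \<Rightarrow> real) \<Rightarrow> 'a) \<Rightarrow> rat) set \<Rightarrow> 'a chain set \<Rightarrow> rat" where
  "kronecker n X A = (\<lambda>a\<in>carrier (homology_group n X). chain_eval (crep A) (SOME z. z \<in> a))"

lemma homology_classE:
  assumes "a \<in> carrier (homology_group (int n) X)"
  obtains z where "singular_relcycle n X {} z" "a = homologous_rel_set n X {} z"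
  using assms by (auto simp: carrier_relative_homology_group)

lemma homologous_rel_set_hom:
  "homologous_rel_set n X S \<in> hom (relcycle_group n X S) (relative_homology_group (int n) X S)"
  using normal.r_coset_hom_Mod[OF normal_subgroup_singular_relboundary_relcycle, of n X S]
  by (simp add: nontrivial_relative_homology_group right_coset_singular_relboundary)

lemma kronecker_crep:
  assumes A: "A \<in> rat_cohomology (int n) X" and z: "singular_relcycle n X {} z"
  shows "kronecker (int n) X A (homologous_rel_set n X {} z) = chain_eval (crep A) z"
proof -
  have "(SOME w. w \<in> homologous_rel_set n X {} z) \<in> homologous_rel_set n X {} z"
    by (rule someI[of _ z]) simp
  then have "homologous_rel n X {} z (SOME w. w \<in> homologous_rel_set n X {} z)" by simp
  from chain_eval_homologous[OF rcocycle_crep[OF A] this] z show ?thesis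
    by (simp add: kronecker_def carrier_relative_homology_group)
qed

lemma kronecker_hclass:
  assumes c: "rcocycle (int n) X c" and z: "singular_relcycle n X {} z"
  shows "kronecker (int n) X (hclass (int n) X c) (homologous_rel_set n X {} z) = chain_eval c z"
proof -
  let ?A = "hclass (int n) X c"
  have A: "?A \<in> rat_cohomology (int n) X" using c by (rule hclass_in_cohomology)
  have "c \<in> hclass (int n) X (crep ?A)"
    unfolding hclass_crep[OF A] using c by (rule hclass_self)
  then have "chain_eval (crep ?A) z = chain_eval c z"
    using z by (intro chain_eval_cohomologous) (auto simp: hclass_def)
  then show ?thesis using kronecker_crep[OF A z] by simp
qed

text \<open>The zero cochain is the only one in negative degree. Homology is trivial there too, so
  the duality extends to all integers.\<close>

lemma rat_cohomology_neg: "n < 0 \<Longrightarrow> rat_cohomology n X = {{\<lambda>_. 0}}"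
  by (auto simp: rat_cohomology_def hclass_def rcocycle_def rcochain_def rcoboundary_def
      intro!: exI[of _ "\<lambda>_. 0"])

lemma crep_neg:
  assumes "n < 0" "A \<in> rat_cohomology n X" shows "crep A = (\<lambda>_. 0)"
  using assms by (simp add: rat_cohomology_neg crep_def)

lemma kronecker_neg: "n < 0 \<Longrightarrow> A \<in> rat_cohomology n X \<Longrightarrow> a \<in> carrier (homology_group n X)
    \<Longrightarrow> kronecker n X A a = 0"
  by (simp add: kronecker_def crep_neg)

lemma kronecker_rat_dual:
  assumes "A \<in> rat_cohomology n X"
  shows "kronecker n X A \<in> rat_dual (homology_group n X)"
  unfolding rat_dual_def
proof (intro CollectI conjI ballI)
  show "kronecker n X A \<in> extensional (carrier (homology_group n X))"
    by (simp add: kronecker_def)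
  fix a b assume a: "a \<in> carrier (homology_group n X)" and b: "b \<in> carrier (homology_group n X)"
  show "kronecker n X A (a \<otimes>\<^bsub>homology_group n X\<^esub> b) = kronecker n X A a + kronecker n X A b"
  proof (cases "n < 0")
    case True
    then show ?thesis
      using assms a b by (simp add: kronecker_neg group.is_monoid monoid.m_closed)
  next
    case False
    then obtain m where n: "n = int m" by (metis int_nat_eq not_less)
    obtain z where z: "singular_relcycle m X {} z" "a = homologous_rel_set m X {} z"
      using a unfolding n by (rule homology_classE)
    obtain w where w: "singular_relcycle m X {} w" "b = homologous_rel_set m X {} w"
      using b unfolding n by (rule homology_classE)
    note zw = z w
    have "a \<otimes>\<^bsub>homology_group n X\<^esub> b = homologous_rel_set m X {} (z + w)"
      using hom_mult[OF homologous_rel_set_hom[of m X "{}"], of z w] zw n by simp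
    then show ?thesis
      using zw assms by (simp add: n kronecker_crep singular_relcycle_add chain_eval_add)
  qed
qed

lemma kronecker_inj:
  assumes "A \<in> rat_cohomology n X" "B \<in> rat_cohomology n X"
    and eq: "kronecker n X A = kronecker n X B"
  shows "A = B"
proof (cases "n < 0")
  case True
  then show ?thesis using assms by (simp add: rat_cohomology_neg)
next
  case False
  then obtain m where n: "n = int m" by (metis int_nat_eq not_less)
  have "rcoboundary n X (\<lambda>\<sigma>. crep A \<sigma> - crep B \<sigma>)"
    unfolding n
  proof (rule rcoboundary_of_vanishing)
    show "rcochain (int m) X (\<lambda>\<sigma>. crep A \<sigma> - crep B \<sigma>)"
      using rcocycle_crep[OF assms(1)] rcocycle_crep[OF assms(2)] n
      by (simp add: rcochain_diff rcocycle_def)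
    fix z assume z: "singular_relcycle m X {} z"
    show "chain_eval (\<lambda>\<sigma>. crep A \<sigma> - crep B \<sigma>) z = 0"
      using kronecker_crep[of A m X z] kronecker_crep[of B m X z] z assms n
      by (simp add: chain_eval_diff_fun)
  qed
  then show ?thesis
    using hclass_eqI hclass_crep[OF assms(1)] hclass_crep[OF assms(2)] by metis
qed

text \<open>The functional is pulled back to cycles, extended to all chains by injectivity of the
  rationals and read off on simplices. The resulting cochain is closed because boundaries represent
  the trivial class.\<close>

lemma kronecker_surj:
  assumes \<phi>: "\<phi> \<in> rat_dual (homology_group n X)"
  obtains A where "A \<in> rat_cohomology n X" "kronecker n X A = \<phi>"
proof (cases "n < 0")
  case True
  obtain A where A: "A \<in> rat_cohomology n X" using True by (auto simp: rat_cohomology_neg)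
  have "kronecker n X A = \<phi>"
  proof (rule rat_dual_eqI[OF kronecker_rat_dual[OF A] \<phi>])
    fix a assume a: "a \<in> carrier (homology_group n X)"
    then have "a = \<one>\<^bsub>homology_group n X\<^esub>"
      using trivial_relative_homology_group[OF True, of X "{}"] by (simp add: trivial_group_def)
    then have "\<phi> a = 0" using rat_dual_one[OF _ \<phi>] by simp
    then show "kronecker n X A a = \<phi> a" using True A a by (simp add: kronecker_neg)
  qed
  with A show thesis by (rule that)
next
  case False
  then obtain m where n: "n = int m" by (metis int_nat_eq not_less)
  note \<phi>' = \<phi>[unfolded n]
  let ?Z = "relcycle_group m X {}" and ?C = "chain_group m X"
  define f where "f = (\<lambda>z\<in>carrier ?Z. \<phi> (homologous_rel_set m X {} z))"
  have f: "f \<in> rat_dual ?Z"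
    unfolding f_def by (rule rat_dual_comp[OF _ homologous_rel_set_hom \<phi>']) simp
  have id: "id \<in> hom ?Z ?C" by (auto simp: hom_def singular_cycle)
  obtain f' where f': "f' \<in> rat_dual ?C" "\<And>z. z \<in> carrier ?Z \<Longrightarrow> f' (id z) = f z"
  proof (rule comm_group.rat_dual_factor[OF abelian_chain_group group_relcycle_group id f])
    fix z assume "z \<in> carrier ?Z" "id z = \<one>\<^bsub>?C\<^esub>"
    then show "f z = 0" using rat_dual_one[OF _ f] by simp
  qed (rule that)
  obtain c where c: "rcochain (int m) X c" "\<And>z. singular_chain m X z \<Longrightarrow> chain_eval c z = f' z"
    using rat_dual_chain_group[OF f'(1)] by blast
  have ev: "chain_eval c z = \<phi> (homologous_rel_set m X {} z)" if "singular_relcycle m X {} z" for z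
    using that f'(2)[of z] c(2)[of z] by (simp add: f_def singular_cycle)
  have "rcobd (int m) X c \<sigma> = 0" for \<sigma>
  proof (cases "singular_simplex (Suc m) X \<sigma>")
    case True
    then have "singular_chain (Suc m) X (frag_of \<sigma>)" by (simp add: singular_chain_of)
    then have bd: "singular_relboundary m X {} (chain_boundary (Suc m) (frag_of \<sigma>))"
      unfolding singular_boundary by blast
    then have "homologous_rel_set m X {} (chain_boundary (Suc m) (frag_of \<sigma>))
        = \<one>\<^bsub>homology_group (int m) X\<^esub>"
      by (simp add: homologous_rel_set_eq_relboundary)
    then show ?thesis
      using True ev[OF singular_relboundary_imp_relcycle[OF bd]] rat_dual_one[OF _ \<phi>']
      by (simp add: rcobd_eq_chain_eval)
  qed (simp add: rcobd_def)
  then have coc: "rcocycle (int m) X c" using c(1) by (auto simp: rcocycle_def)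
  show thesis
  proof
    show A: "hclass n X c \<in> rat_cohomology n X"
      using coc n by (simp add: hclass_in_cohomology)
    show "kronecker n X (hclass n X c) = \<phi>"
    proof (rule rat_dual_eqI[OF kronecker_rat_dual[OF A] \<phi>])
      fix a assume "a \<in> carrier (homology_group n X)"
      then obtain z where "singular_relcycle m X {} z" "a = homologous_rel_set m X {} z"
        unfolding n by (rule homology_classE)
      then show "kronecker n X (hclass n X c) a = \<phi> a"
        using ev coc by (simp add: n kronecker_hclass)
    qed
  qed
qed

theorem kronecker_bij:
  "bij_betw (kronecker n X) (rat_cohomology n X) (rat_dual (homology_group n X))"
  unfolding bij_betw_def
proof
  show "inj_on (kronecker n X) (rat_cohomology n X)"
    by (rule inj_onI) (rule kronecker_inj)
  show "kronecker n X ` rat_cohomology n X = rat_dual (homology_group n X)"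
  proof
    show "rat_dual (homology_group n X) \<subseteq> kronecker n X ` rat_cohomology n X"
    proof
      fix \<phi> assume "\<phi> \<in> rat_dual (homology_group n X)"
      then obtain A where "A \<in> rat_cohomology n X" "kronecker n X A = \<phi>" by (rule kronecker_surj)
      then show "\<phi> \<in> kronecker n X ` rat_cohomology n X" by blast
    qed
  qed (use kronecker_rat_dual in blast)
qed


text \<open>One chain \<open>z\<close> serves all cohomology classes at once, with
  \<open>z = 0\<close> in negative degrees. Identities between pairings thus reduce to linearity on
  chains, without a case split on the degree.\<close>

lemma kronecker_eval:
  assumes "a \<in> carrier (homology_group n X)"
  obtains z where "\<And>A. A \<in> rat_cohomology n X \<Longrightarrow> kronecker n X A a = chain_eval (crep A) z"
    "\<And>c. rcocycle n X c \<Longrightarrow> kronecker n X (hclass n X c) a = chain_eval c z"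
proof (cases "n < 0")
  case True
  have "kronecker n X (hclass n X c) a = chain_eval c 0" if "rcocycle n X c" for c
    using that True assms by (simp add: kronecker_neg hclass_in_cohomology)
  with True assms show ?thesis by (intro that[of 0]) (simp_all add: kronecker_neg)
next
  case False
  then obtain m where n: "n = int m" by (metis int_nat_eq not_less)
  obtain z where "singular_relcycle m X {} z" "a = homologous_rel_set m X {} z"
    using assms unfolding n by (rule homology_classE)
  then show ?thesis using that[of z] by (simp add: n kronecker_crep kronecker_hclass)
qed

section \<open>The pairing and the linear operations on classes\<close>

lemma cadd_in_cohomology:
  "A \<in> rat_cohomology n X \<Longrightarrow> B \<in> rat_cohomology n X \<Longrightarrow> cadd n X A B \<in> rat_cohomology n X"
  by (simp add: cadd_def hclass_in_cohomology rcocycle_add rcocycle_crep)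

lemma cscale_in_cohomology: "A \<in> rat_cohomology n X \<Longrightarrow> cscale n X r A \<in> rat_cohomology n X"
  by (simp add: cscale_def hclass_in_cohomology rcocycle_scale rcocycle_crep)

lemma czero_in_cohomology: "czero n X \<in> rat_cohomology n X"
  by (simp add: czero_def hclass_in_cohomology rcocycle_zero)

lemma kronecker_cadd:
  assumes "A \<in> rat_cohomology n X" "B \<in> rat_cohomology n X" "a \<in> carrier (homology_group n X)"
  shows "kronecker n X (cadd n X A B) a = kronecker n X A a + kronecker n X B a"
  by (rule kronecker_eval[OF assms(3)])
     (simp add: assms cadd_def rcocycle_add rcocycle_crep chain_eval_add_fun)

lemma kronecker_cscale:
  assumes "A \<in> rat_cohomology n X" "a \<in> carrier (homology_group n X)"
  shows "kronecker n X (cscale n X r A) a = r * kronecker n X A a"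
  by (rule kronecker_eval[OF assms(2)])
     (simp add: assms cscale_def rcocycle_scale rcocycle_crep chain_eval_scale_fun)

lemma kronecker_czero:
  assumes "a \<in> carrier (homology_group n X)"
  shows "kronecker n X (czero n X) a = 0"
  by (rule kronecker_eval[OF assms]) (simp add: czero_def rcocycle_zero)

section \<open>Restriction of classes to a subspace\<close>

lemma rcocycle_restrict:
  assumes "rcocycle n X c"
  shows "rcocycle n (subtopology X S)
    (\<lambda>\<sigma>. if 0 \<le> n \<and> singular_simplex (nat n) (subtopology X S) \<sigma> then c \<sigma> else 0)"
    (is "rcocycle n ?Y ?c")
proof -
  have "rcobd n ?Y ?c \<sigma> = 0" for \<sigma>
  proof (cases "0 \<le> n \<and> singular_simplex (Suc (nat n)) ?Y \<sigma>")
    case True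
    \<comment> \<open>Faces of a simplex in the subspace stay in it, so the coboundary does not see
      the cut-off.\<close>
    have "?c (singular_face (Suc (nat n)) k \<sigma>) = c (singular_face (Suc (nat n)) k \<sigma>)"
      if "k \<le> Suc (nat n)" for k
      using singular_simplex_singular_face[of "Suc (nat n)" ?Y \<sigma> k] True that by simp
    then have "rcobd n ?Y ?c \<sigma> = rcobd n X c \<sigma>"
      using True by (simp add: rcobd_def singular_simplex_subtopology del: sum.atMost_Suc)
    then show ?thesis using assms by (simp add: rcocycle_def)
  qed (auto simp: rcobd_def)
  then show ?thesis by (auto simp: rcocycle_def rcochain_def)
qed

lemma cohom_restrict_in_cohomology:
  "A \<in> rat_cohomology n X \<Longrightarrow> cohom_restrict n X S A \<in> rat_cohomology n (subtopology X S)"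
  by (simp only: cohom_restrict_def hclass_in_cohomology rcocycle_restrict rcocycle_crep)

text \<open>A cycle of the subspace is the very same chain in \<open>X\<close>, so restriction is
  the transpose of the map induced by inclusion.\<close>

lemma kronecker_cohom_restrict:
  assumes A: "A \<in> rat_cohomology n X" and a: "a \<in> carrier (homology_group n (subtopology X S))"
  shows "kronecker n (subtopology X S) (cohom_restrict n X S A) a =
    kronecker n X A (hom_induced n (subtopology X S) {} X {} id a)"
proof (cases "n < 0")
  case True
  then show ?thesis
    using assms by (simp add: kronecker_neg cohom_restrict_in_cohomology hom_induced_carrier)
next
  case False
  then obtain m where n: "n = int m" by (metis int_nat_eq not_less)
  let ?Y = "subtopology X S"
  obtain z where z: "singular_relcycle m ?Y {} z" "a = homologous_rel_set m ?Y {} z"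
    using a unfolding n by (rule homology_classE)
  have zX: "singular_relcycle m X {} z"
    using z(1) by (simp add: singular_cycle singular_chain_subtopology)
  have "chain_map m id z = z"
    using z(1) by (auto simp: singular_cycle intro: chain_map_ident)
  moreover have "hom_induced (int m) ?Y {} X {} id (homologous_rel_set m ?Y {} z) =
      homologous_rel_set m X {} (chain_map m id z)"
    by (rule hom_induced_chain_map) (use z(1) in \<open>auto intro: continuous_map_from_subtopology\<close>)
  ultimately have "kronecker n X A (hom_induced n ?Y {} X {} id a) = chain_eval (crep A) z"
    using kronecker_crep[of A m X z] A zX n z(2) by (simp only:)
  moreover have "kronecker n ?Y (cohom_restrict n X S A) a =
      chain_eval (\<lambda>\<sigma>. if 0 \<le> n \<and> singular_simplex (nat n) ?Y \<sigma> then crep A \<sigma> else 0) z"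
    using kronecker_hclass[OF _ z(1), OF rcocycle_restrict[OF rcocycle_crep[OF A], of S, unfolded n]]
    by (simp only: cohom_restrict_def n z(2))
  moreover have "\<dots> = chain_eval (crep A) z"
    using z(1) by (intro chain_eval_cong) (auto simp: n singular_cycle singular_chain_def)
  ultimately show ?thesis by simp
qed

section \<open>Transposed maps and exactness of the dual sequence\<close>

definition dual_map ::
  "int \<Rightarrow> 'a topology \<Rightarrow> int \<Rightarrow> 'b topology \<Rightarrow> ('b chain set \<Rightarrow> 'a chain set)
   \<Rightarrow> (((nat \<Rightarrow> real) \<Rightarrow> 'a) \<Rightarrow> rat) set \<Rightarrow> (((nat \<Rightarrow> real) \<Rightarrow> 'b) \<Rightarrow> rat) set" where
  "dual_map n X m Y \<theta> A = inv_into (rat_cohomology m Y) (kronecker m Y)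
     (\<lambda>a\<in>carrier (homology_group m Y). kronecker n X A (\<theta> a))"

text \<open>The composed functional lies in the range of the pairing because \<open>\<theta>\<close>
  is a homomorphism, so \<open>inv_into\<close> returns a genuine class.\<close>

lemma
  assumes "\<theta> \<in> hom (homology_group m Y) (homology_group n X)" "A \<in> rat_cohomology n X"
  shows dual_map_in_cohomology: "dual_map n X m Y \<theta> A \<in> rat_cohomology m Y"
    and kronecker_dual_map: "a \<in> carrier (homology_group m Y) \<Longrightarrow>
          kronecker m Y (dual_map n X m Y \<theta> A) a = kronecker n X A (\<theta> a)"
proof -
  have *: "(\<lambda>a\<in>carrier (homology_group m Y). kronecker n X A (\<theta> a)) \<in> kronecker m Y ` rat_cohomology m Y"
    using rat_dual_comp[OF _ assms(1) kronecker_rat_dual[OF assms(2)]]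
      bij_betw_imp_surj_on[OF kronecker_bij, of m Y] by simp
  show "dual_map n X m Y \<theta> A \<in> rat_cohomology m Y"
    unfolding dual_map_def by (rule inv_into_into[OF *])
  show "kronecker m Y (dual_map n X m Y \<theta> A) a = kronecker n X A (\<theta> a)"
    if "a \<in> carrier (homology_group m Y)"
    unfolding dual_map_def f_inv_into_f[OF *] using that by simp
qed

lemma cohomology_eqI:
  assumes "A \<in> rat_cohomology n X" "B \<in> rat_cohomology n X"
    "\<And>a. a \<in> carrier (homology_group n X) \<Longrightarrow> kronecker n X A a = kronecker n X B a"
  shows "A = B"
  using rat_dual_eqI[OF kronecker_rat_dual[OF assms(1)] kronecker_rat_dual[OF assms(2)]]
  by (intro kronecker_inj[OF assms(1,2)]) (simp add: assms(3))

lemma cohom_linear_dual_map: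
  assumes \<theta>: "\<theta> \<in> hom (homology_group m Y) (homology_group n X)"
  shows "cohom_linear n X m Y (dual_map n X m Y \<theta>)"
  unfolding cohom_linear_def
proof (intro conjI ballI allI)
  show "dual_map n X m Y \<theta> \<in> rat_cohomology n X \<rightarrow> rat_cohomology m Y"
    using dual_map_in_cohomology[OF \<theta>] by blast
  fix A assume A: "A \<in> rat_cohomology n X"
  show "dual_map n X m Y \<theta> (cscale n X r A) = cscale m Y r (dual_map n X m Y \<theta> A)" for r
    using A \<theta> hom_in_carrier[OF \<theta>]
    by (intro cohomology_eqI[of _ m Y])
       (simp_all add: cscale_in_cohomology dual_map_in_cohomology kronecker_dual_map kronecker_cscale)
  fix B assume "B \<in> rat_cohomology n X"
  then show "dual_map n X m Y \<theta> (cadd n X A B) = cadd m Y (dual_map n X m Y \<theta> A) (dual_map n X m Y \<theta> B)"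
    using A \<theta> hom_in_carrier[OF \<theta>]
    by (intro cohomology_eqI[of _ m Y])
       (simp_all add: cadd_in_cohomology dual_map_in_cohomology kronecker_dual_map kronecker_cadd)
qed

lemma cohom_restrict_eq_dual_map:
  assumes "A \<in> rat_cohomology n X"
  shows "cohom_restrict n X S A =
    dual_map n X n (subtopology X S) (hom_induced n (subtopology X S) {} X {} id) A"
  using assms hom_induced_hom[of n "subtopology X S" "{}" X "{}" id]
  by (intro cohomology_eqI[of _ n "subtopology X S"])
     (simp_all add: cohom_restrict_in_cohomology dual_map_in_cohomology kronecker_dual_map
       kronecker_cohom_restrict)

text \<open>A class killed by the transpose of \<open>\<beta>\<close> vanishes on the image of
  \<open>\<beta>\<close>, which is the kernel of \<open>\<alpha>\<close>. Its functional therefore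
  factors through \<open>\<alpha>\<close>, and injectivity of the rationals extends the factor to
  the homology of \<open>X1\<close>. The converse inclusion is the triviality of the composite of
  \<open>\<alpha>\<close> and \<open>\<beta>\<close>.\<close>

proposition cohom_exact_dual_map:
  assumes \<alpha>: "\<alpha> \<in> hom (homology_group n2 X2) (homology_group n1 X1)"
    and \<beta>: "\<beta> \<in> hom (homology_group n3 X3) (homology_group n2 X2)"
    and exact: "\<beta> ` carrier (homology_group n3 X3)
      = kernel (homology_group n2 X2) (homology_group n1 X1) \<alpha>"
  shows "cohom_exact n1 X1 n2 X2 n3 X3 (dual_map n1 X1 n2 X2 \<alpha>) (dual_map n2 X2 n3 X3 \<beta>)"
  unfolding cohom_exact_def
proof (intro subset_antisym subsetI)
  fix B assume "B \<in> {B \<in> rat_cohomology n2 X2. dual_map n2 X2 n3 X3 \<beta> B = czero n3 X3}"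
  then have B: "B \<in> rat_cohomology n2 X2" "dual_map n2 X2 n3 X3 \<beta> B = czero n3 X3" by auto
  have van: "kronecker n2 X2 B (\<beta> a) = 0" if "a \<in> carrier (homology_group n3 X3)" for a
    using kronecker_dual_map[OF \<beta> B(1) that] B(2) kronecker_czero[OF that] by simp
  obtain f' where f': "f' \<in> rat_dual (homology_group n1 X1)"
    "\<And>b. b \<in> carrier (homology_group n2 X2) \<Longrightarrow> f' (\<alpha> b) = kronecker n2 X2 B b"
  proof (rule comm_group.rat_dual_factor[OF abelian_homology_group group_relative_homology_group \<alpha> kronecker_rat_dual[OF B(1)]])
    fix b assume "b \<in> carrier (homology_group n2 X2)" "\<alpha> b = \<one>\<^bsub>homology_group n1 X1\<^esub>"
    then have "b \<in> \<beta> ` carrier (homology_group n3 X3)" by (simp add: exact kernel_def)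
    then show "kronecker n2 X2 B b = 0" using van by auto
  qed (rule that)
  obtain A where A: "A \<in> rat_cohomology n1 X1" "kronecker n1 X1 A = f'"
    using kronecker_surj[OF f'(1)] .
  have "B = dual_map n1 X1 n2 X2 \<alpha> A"
    using A B(1) \<alpha> f'(2)
    by (intro cohomology_eqI[of _ n2 X2]) (simp_all add: dual_map_in_cohomology kronecker_dual_map)
  with A(1) show "B \<in> dual_map n1 X1 n2 X2 \<alpha> ` rat_cohomology n1 X1" by blast
next
  fix B assume "B \<in> dual_map n1 X1 n2 X2 \<alpha> ` rat_cohomology n1 X1"
  then obtain A where A: "A \<in> rat_cohomology n1 X1" "B = dual_map n1 X1 n2 X2 \<alpha> A" by blast
  have B: "B \<in> rat_cohomology n2 X2" using A \<alpha> by (simp add: dual_map_in_cohomology)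
  have "dual_map n2 X2 n3 X3 \<beta> B = czero n3 X3"
  proof (rule cohomology_eqI)
    fix a assume a: "a \<in> carrier (homology_group n3 X3)"
    then have \<beta>a: "\<beta> a \<in> carrier (homology_group n2 X2)" "\<alpha> (\<beta> a) = \<one>\<^bsub>homology_group n1 X1\<^esub>"
      using exact by (auto simp: kernel_def)
    have "kronecker n3 X3 (dual_map n2 X2 n3 X3 \<beta> B) a = kronecker n1 X1 A (\<alpha> (\<beta> a))"
      using a \<beta>a A \<alpha> \<beta> B by (simp add: kronecker_dual_map)
    also have "\<dots> = 0"
      using \<beta>a(2) rat_dual_one[OF _ kronecker_rat_dual[OF A(1)]] by simp
    finally show "kronecker n3 X3 (dual_map n2 X2 n3 X3 \<beta> B) a = kronecker n3 X3 (czero n3 X3) a"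
      using a by (simp add: kronecker_czero)
  qed (use B \<beta> in \<open>simp_all add: dual_map_in_cohomology czero_in_cohomology\<close>)
  with B show "B \<in> {B \<in> rat_cohomology n2 X2. dual_map n2 X2 n3 X3 \<beta> B = czero n3 X3}" by simp
qed

lemma cohom_exact_cong:
  assumes "\<And>A. A \<in> rat_cohomology n1 X1 \<Longrightarrow> f A = f' A"
    "\<And>B. B \<in> rat_cohomology n2 X2 \<Longrightarrow> g B = g' B"
  shows "cohom_exact n1 X1 n2 X2 n3 X3 f g \<longleftrightarrow> cohom_exact n1 X1 n2 X2 n3 X3 f' g'"
proof -
  have "f ` rat_cohomology n1 X1 = f' ` rat_cohomology n1 X1" using assms(1) by (rule image_cong[OF refl])
  moreover have "{B \<in> rat_cohomology n2 X2. g B = czero n3 X3} =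
      {B \<in> rat_cohomology n2 X2. g' B = czero n3 X3}"
    by (rule Collect_cong) (simp add: assms(2) cong: conj_cong)
  ultimately show ?thesis by (simp add: cohom_exact_def)
qed

subsection \<open>The Thom isomorphism in homology\<close>

text \<open>The predicate makes every stage send \<open>S'\<close> into \<open>T'\<close>, so this
  is a homotopy of pairs; \<open>S' = {}\<close> gives the absolute version.\<close>

lemma homotopic_with_straight_line:
  fixes f g :: "'a::topological_space \<Rightarrow> 'b::real_normed_vector"
  assumes f: "continuous_on S f" and g: "continuous_on S g"
    and T: "\<And>x t. x \<in> S \<Longrightarrow> 0 \<le> t \<Longrightarrow> t \<le> 1 \<Longrightarrow> (1 - t) *\<^sub>R f x + t *\<^sub>R g x \<in> T"
    and T': "\<And>x t. x \<in> S' \<Longrightarrow> 0 \<le> t \<Longrightarrow> t \<le> 1 \<Longrightarrow> (1 - t) *\<^sub>R f x + t *\<^sub>R g x \<in> T'"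
  shows "homotopic_with (\<lambda>h. h \<in> S' \<rightarrow> T') (top_of_set S) (top_of_set T) f g"
  unfolding homotopic_with_def
proof (intro exI conjI allI ballI)
  let ?h = "\<lambda>y. (1 - fst y) *\<^sub>R f (snd y) + fst y *\<^sub>R g (snd y)"
  have "continuous_on ({0..1} \<times> S) ?h"
    by (intro continuous_intros continuous_on_compose2[OF f] continuous_on_compose2[OF g]) auto
  then show "continuous_map (prod_topology (top_of_set {0..1::real}) (top_of_set S)) (top_of_set T) ?h"
    using T by (auto simp: Pi_iff)
qed (use T' in auto)

text \<open>The excised set \<open>U - V\<close> is closed in \<open>U\<close> and lies in the open
  set \<open>U - S\<close> because \<open>S \<subseteq> V\<close>. Thus only a neighbourhood of
  \<open>S\<close> matters.\<close>

lemma relative_homology_excise_complement: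
  assumes V: "openin (top_of_set U) V" and S: "closedin (top_of_set U) S" and "S \<subseteq> V"
  shows "relative_homology_group p (top_of_set V) (V - S)
      \<cong> relative_homology_group p (top_of_set U) (U - S)"
proof -
  have sub: "V \<subseteq> U" "S \<subseteq> U" using V S by (auto dest: openin_imp_subset closedin_imp_subset)
  have "hom_induced p (subtopology (top_of_set U) (U - (U - V))) (U - S - (U - V))
      (subtopology (top_of_set U) U) (U - S) id
    \<in> iso (relative_homology_group p (subtopology (top_of_set U) (U - (U - V))) (U - S - (U - V)))
          (relative_homology_group p (subtopology (top_of_set U) U) (U - S))"
  proof (rule homology_excision_axiom)
    have "top_of_set U closure_of (U - V) = U - V"
      using V by (intro closure_of_closedin) (auto simp: openin_closedin_eq)
    moreover have "top_of_set U interior_of (U - S) = U - S"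
      using S by (intro interior_of_openin) (auto simp: closedin_def)
    ultimately show "top_of_set U closure_of (U - V) \<subseteq> top_of_set U interior_of (U - S)"
      using \<open>S \<subseteq> V\<close> by auto
  qed auto
  moreover have "subtopology (top_of_set U) (U - (U - V)) = top_of_set V"
    "subtopology (top_of_set U) U = top_of_set U" "U - S - (U - V) = V - S"
    using sub by (auto simp: subtopology_subtopology Int_absorb1 double_diff intro: arg_cong[of _ _ "subtopology euclidean"])
  ultimately show ?thesis unfolding is_iso_def by auto
qed

text \<open>The set \<open>Y\<close> is \<open>X \<times> \<real>\<close>, realised inside the ambient space along the unit vector \<open>e\<close>. The sets
  \<open>A\<close> and \<open>B\<close> below arise from \<open>Y\<close> by removing the closed upper and lower half cylinders over \<open>S\<close>.
  They are open, \<open>A \<union> B = Y - S\<close>, the pair \<open>(Y, A)\<close> is acyclic, and \<open>(B, A \<inter> B)\<close>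
  is homotopy equivalent to \<open>(X, X - S)\<close>.\<close>

proposition relative_homology_line_thickening:
  fixes X S :: "'a::euclidean_space set" and e :: 'a
  defines "Y \<equiv> {y. y - (y \<bullet> e) *\<^sub>R e \<in> X}"
  assumes e: "e \<bullet> e = 1" and X: "\<And>x. x \<in> X \<Longrightarrow> x \<bullet> e = 0" and S: "closedin (top_of_set X) S"
  shows "relative_homology_group p (top_of_set Y) (Y - S)
      \<cong> relative_homology_group (p - 1) (top_of_set X) (X - S)"
    and "closedin (top_of_set Y) S"
proof -
  define \<pi> where "\<pi> = (\<lambda>y. y - (y \<bullet> e) *\<^sub>R e)"
  have Y: "y \<in> Y \<longleftrightarrow> \<pi> y \<in> X" for y by (simp add: Y_def \<pi>_def)
  have cont\<pi>: "continuous_on T \<pi>" for T unfolding \<pi>_def by (intro continuous_intros)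
  have \<pi>_line: "\<pi> (\<pi> y + s *\<^sub>R e) = \<pi> y" "(\<pi> y + s *\<^sub>R e) \<bullet> e = s" for y s
    by (simp_all add: \<pi>_def inner_simps e)
  have \<pi>_line_minus: "\<pi> (\<pi> y - e) = \<pi> y" "(\<pi> y - e) \<bullet> e = - 1" for y
    using \<pi>_line[of y "- 1"] by simp_all
  have \<pi>_decomp: "y = \<pi> y + (y \<bullet> e) *\<^sub>R e" for y by (simp add: \<pi>_def)
  have \<pi>_X: "\<pi> x = x" if "x \<in> X" for x using X[OF that] by (simp add: \<pi>_def)
  have "S \<subseteq> X" using S by (rule closedin_imp_subset)
  have mem_S: "y \<in> S \<longleftrightarrow> \<pi> y \<in> S \<and> y \<bullet> e = 0" if "y \<in> Y" for y
  proof -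
    have "\<pi> y = y" if "y \<bullet> e = 0" using that by (simp add: \<pi>_def)
    then show ?thesis using \<pi>_X X \<open>S \<subseteq> X\<close> by auto
  qed
  have closed_pre: "closedin (top_of_set Y) {y \<in> Y. \<pi> y \<in> S}"
    using continuous_closedin_preimage_gen[OF cont\<pi> _ S, of Y] Y
    by (auto simp: vimage_def Int_def)
  define A where "A = {y \<in> Y. \<pi> y \<in> S \<longrightarrow> y \<bullet> e < 0}"
  define B where "B = {y \<in> Y. \<pi> y \<in> S \<longrightarrow> 0 < y \<bullet> e}"
  have A: "openin (top_of_set Y) A"
  proof -
    have "closedin (top_of_set Y) ({y \<in> Y. \<pi> y \<in> S} \<inter> (Y \<inter> {y. 0 \<le> y \<bullet> e}))"
      by (intro closedin_Int closed_pre closedin_closed_Int closed_Collect_le continuous_intros)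
    moreover have "{y \<in> Y. \<pi> y \<in> S} \<inter> (Y \<inter> {y. 0 \<le> y \<bullet> e}) = Y - A" by (auto simp: A_def)
    ultimately show ?thesis by (simp add: openin_closedin_eq A_def)
  qed
  have B: "openin (top_of_set Y) B"
  proof -
    have "closedin (top_of_set Y) ({y \<in> Y. \<pi> y \<in> S} \<inter> (Y \<inter> {y. y \<bullet> e \<le> 0}))"
      by (intro closedin_Int closed_pre closedin_closed_Int closed_Collect_le continuous_intros)
    moreover have "{y \<in> Y. \<pi> y \<in> S} \<inter> (Y \<inter> {y. y \<bullet> e \<le> 0}) = Y - B" by (auto simp: B_def)
    ultimately show ?thesis by (simp add: openin_closedin_eq B_def)
  qed
  have "S \<subseteq> Y" using \<open>S \<subseteq> X\<close> \<pi>_X Y by auto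
  show "closedin (top_of_set Y) S"
  proof -
    have "closedin (top_of_set Y) ({y \<in> Y. \<pi> y \<in> S} \<inter> (Y \<inter> {y. y \<bullet> e = 0}))"
      by (intro closedin_Int closed_pre closedin_closed_Int closed_Collect_eq continuous_intros)
    moreover have "{y \<in> Y. \<pi> y \<in> S} \<inter> (Y \<inter> {y. y \<bullet> e = 0}) = S"
      using mem_S \<open>S \<subseteq> Y\<close> by blast
    ultimately show ?thesis by simp
  qed
  have AB: "Y - S = A \<union> B" "A \<subseteq> Y - S" "B \<subseteq> Y - S"
    using mem_S by (auto simp: A_def B_def)

  \<comment> \<open>Sliding along \<open>e\<close> to height -1 moves \<open>Y\<close> into
    \<open>A\<close>, and the slide preserves \<open>A\<close>, where heights over \<open>S\<close>
    are negative.\<close>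
  have acyclic: "trivial_group (relative_homology_group q (top_of_set Y) A)" for q
  proof (rule trivial_relative_homology_group_gen)
    let ?f = "\<lambda>y. \<pi> y + (- 1) *\<^sub>R e"
    have subA: "subtopology (top_of_set Y) A = top_of_set A"
      using AB by (auto simp: subtopology_subtopology intro!: arg_cong[of _ _ "subtopology euclidean"])
    have cont: "continuous_on T ?f" for T by (intro continuous_intros cont\<pi>)
    have path: "(1 - t) *\<^sub>R ?f y + t *\<^sub>R id y = \<pi> y + (t * (y \<bullet> e) - (1 - t)) *\<^sub>R e" for t y
      by (subst (2) \<pi>_decomp) (simp add: algebra_simps)
    have pathA: "(1 - t) *\<^sub>R ?f y + t *\<^sub>R id y \<in> A"
      if "y \<in> A" "0 \<le> t" "t \<le> 1" for y t
    proof -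
      have "t * (y \<bullet> e) - (1 - t) < 0" if "y \<bullet> e < 0"
      proof (cases "t = 0")
        case False
        then have "t * (y \<bullet> e) < 0" using that \<open>0 \<le> t\<close> by (simp add: mult_pos_neg)
        then show ?thesis using \<open>t \<le> 1\<close> by simp
      qed simp
      then show ?thesis using \<open>y \<in> A\<close> unfolding path by (auto simp: A_def Y \<pi>_line)
    qed
    have pathY: "(1 - t) *\<^sub>R ?f y + t *\<^sub>R id y \<in> Y" if "y \<in> Y" for y t
      using that unfolding path by (simp add: Y \<pi>_line)
    show "continuous_map (top_of_set Y) (subtopology (top_of_set Y) A) ?f"
      unfolding subA using cont by (auto simp: A_def Y \<pi>_line_minus Pi_iff)
    show "homotopic_with (\<lambda>h. True) (subtopology (top_of_set Y) A) (subtopology (top_of_set Y) A) ?f id"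
      unfolding subA
      by (rule homotopic_with_mono[OF homotopic_with_straight_line[of A ?f id A "{}" "{}"]])
         (use pathA cont in auto)
    show "homotopic_with (\<lambda>h. True) (top_of_set Y) (top_of_set Y) ?f id"
      by (rule homotopic_with_mono[OF homotopic_with_straight_line[of Y ?f id Y "{}" "{}"]])
         (use pathY cont in auto)
  qed

  have subYS: "subtopology (top_of_set Y) (Y - S) = top_of_set (Y - S)"
    by (auto simp: subtopology_subtopology intro!: arg_cong[of _ _ "subtopology euclidean"])
  \<comment> \<open>In the exact sequence of the triple
    \<open>A \<subseteq> Y - S \<subseteq> Y\<close> the groups of \<open>(Y, A)\<close> vanish, so
    the boundary map is an isomorphism; it lowers the degree by one.\<close>
  have "hom_relboundary p (top_of_set Y) (Y - S) A \<in>
      iso (relative_homology_group p (top_of_set Y) (Y - S))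
          (relative_homology_group (p - 1) (top_of_set (Y - S)) A)"
  proof (rule very_short_exact_sequence)
    show "exact_seq
     ([relative_homology_group (p - 1) (top_of_set Y) A,
       relative_homology_group (p - 1) (top_of_set (Y - S)) A,
       relative_homology_group p (top_of_set Y) (Y - S),
       relative_homology_group p (top_of_set Y) A],
      [hom_induced (p - 1) (top_of_set (Y - S)) A (top_of_set Y) A id,
       hom_relboundary p (top_of_set Y) (Y - S) A,
       hom_induced p (top_of_set Y) A (top_of_set Y) (Y - S) id])"
      using homology_exactness_triple_1[OF AB(2), of p "top_of_set Y"]
        homology_exactness_triple_2[OF AB(2), of p "top_of_set Y"]
      unfolding subYS by simp
  qed (use acyclic in auto)
  then have 1: "relative_homology_group p (top_of_set Y) (Y - S)
      \<cong> relative_homology_group (p - 1) (top_of_set (Y - S)) A"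
    by (auto simp: is_iso_def)

  \<comment> \<open>The closed set of the excision lemma is \<open>Y - S - A\<close>, which lies in
    \<open>B\<close>; what gets excised is the part of \<open>A\<close> outside
    \<open>B\<close>.\<close>
  have "relative_homology_group (p - 1) (top_of_set B) (B - (Y - S - A))
      \<cong> relative_homology_group (p - 1) (top_of_set (Y - S)) (Y - S - (Y - S - A))"
  proof (rule relative_homology_excise_complement)
    show "openin (top_of_set (Y - S)) B"
      using B AB(3) by (rule openin_subset_trans) auto
    have "openin (top_of_set (Y - S)) A"
      using A AB(2) by (rule openin_subset_trans) auto
    then show "closedin (top_of_set (Y - S)) (Y - S - A)"
      by (simp add: openin_closedin_eq)
  qed (use AB in auto)
  moreover have "B - (Y - S - A) = A \<inter> B" "Y - S - (Y - S - A) = A" using AB by auto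
  ultimately have 2: "relative_homology_group (p - 1) (top_of_set B) (A \<inter> B)
      \<cong> relative_homology_group (p - 1) (top_of_set (Y - S)) A"
    by simp

  have 3: "relative_homology_group (p - 1) (top_of_set B) (A \<inter> B)
      \<cong> relative_homology_group (p - 1) (top_of_set X) (X - S)"
  proof (rule homotopy_equivalent_space_imp_isomorphic_relative_homology_groups)
    \<comment> \<open>No height is both negative and positive, so \<open>A \<inter> B\<close>
      consists of the points of \<open>Y\<close> whose projection misses \<open>S\<close>. The
      section sits at height 1 because \<open>B\<close> has only positive heights over
      \<open>S\<close>.\<close>
    let ?g = "\<lambda>x. x + 1 *\<^sub>R e"
    have \<pi>g: "\<pi> (?g x) = x" "?g x \<bullet> e = 1" if "x \<in> X" for x
      using \<pi>_line[of x 1] \<pi>_X[OF that] by simp_all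
    show "continuous_map (top_of_set B) (top_of_set X) \<pi>"
      using cont\<pi> by (auto simp: B_def Y)
    show "\<pi> \<in> A \<inter> B \<rightarrow> X - S" by (auto simp: A_def B_def Y)
    show "continuous_map (top_of_set X) (top_of_set B) ?g"
      using \<pi>g by (auto simp: B_def Y intro!: continuous_intros)
    show "?g \<in> X - S \<rightarrow> A \<inter> B" using \<pi>g by (auto simp: A_def B_def Y)
    show "homotopic_with (\<lambda>k. k \<in> X - S \<rightarrow> X - S) (top_of_set X) (top_of_set X) (\<pi> \<circ> ?g) id"
      by (rule homotopic_with_equal) (use \<pi>g in auto)
    have path: "(1 - t) *\<^sub>R (?g \<circ> \<pi>) y + t *\<^sub>R id y = \<pi> y + ((1 - t) + t * (y \<bullet> e)) *\<^sub>R e" for t y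
      by (subst (2) \<pi>_decomp) (simp add: algebra_simps)
    have pathB: "(1 - t) *\<^sub>R (?g \<circ> \<pi>) y + t *\<^sub>R id y \<in> B"
      if "y \<in> B" "0 \<le> t" "t \<le> 1" for y t
    proof -
      have "0 < (1 - t) + t * (y \<bullet> e)" if "0 < y \<bullet> e"
        using that \<open>0 \<le> t\<close> \<open>t \<le> 1\<close> by (cases "t = 0") (simp_all add: add_nonneg_pos)
      then show ?thesis using \<open>y \<in> B\<close> unfolding path by (auto simp: B_def Y \<pi>_line)
    qed
    moreover have "(1 - t) *\<^sub>R (?g \<circ> \<pi>) y + t *\<^sub>R id y \<in> A \<inter> B" if "y \<in> A \<inter> B" for y t
    proof -
      have "\<pi> y \<in> X" "\<pi> y \<notin> S" using that by (auto simp: A_def B_def Y)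
      then show ?thesis unfolding path by (simp add: A_def B_def Y \<pi>_line)
    qed
    moreover have "continuous_on B (?g \<circ> \<pi>)"
      by (intro continuous_on_compose cont\<pi> continuous_intros)
    ultimately show "homotopic_with (\<lambda>h. h \<in> A \<inter> B \<rightarrow> A \<inter> B) (top_of_set B) (top_of_set B) (?g \<circ> \<pi>) id"
      by (intro homotopic_with_straight_line) auto
  qed
  show "relative_homology_group p (top_of_set Y) (Y - S)
      \<cong> relative_homology_group (p - 1) (top_of_set X) (X - S)"
    by (rule iso_trans[OF 1 iso_trans[OF group.iso_sym[OF group_relative_homology_group 2] 3]])
qed

text \<open>Closedness of \<open>S\<close> in the thickened set belongs to the induction claim
  because the next direction needs it; \<open>p\<close> varies because each direction lowers the
  degree.\<close>

proposition relative_homology_orthonormal_thickening: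
  fixes X S E :: "'a::euclidean_space set"
  assumes "finite E" and "pairwise orthogonal E" and "\<And>e. e \<in> E \<Longrightarrow> norm e = 1"
    and "\<And>x e. x \<in> X \<Longrightarrow> e \<in> E \<Longrightarrow> x \<bullet> e = 0" and "closedin (top_of_set X) S"
  shows "closedin (top_of_set {y. y - (\<Sum>e\<in>E. (y \<bullet> e) *\<^sub>R e) \<in> X}) S \<and>
    relative_homology_group p (top_of_set {y. y - (\<Sum>e\<in>E. (y \<bullet> e) *\<^sub>R e) \<in> X})
      ({y. y - (\<Sum>e\<in>E. (y \<bullet> e) *\<^sub>R e) \<in> X} - S)
      \<cong> relative_homology_group (p - int (card E)) (top_of_set X) (X - S)"
  using assms
proof (induction E arbitrary: p rule: finite_induct)
  case empty
  then show ?case by simp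
next
  case (insert e E)
  define Z where "Z = {y. y - (\<Sum>f\<in>E. (y \<bullet> f) *\<^sub>R f) \<in> X}"
  have orth: "e \<bullet> f = 0" "f \<bullet> e = 0" if "f \<in> E" for f
    using insert.prems(1) insert.hyps(2) that by (auto simp: pairwise_def orthogonal_def)
  have "e \<bullet> e = 1" using insert.prems(2)[of e] by (simp add: dot_square_norm)
  have IH: "closedin (top_of_set Z) S"
    "relative_homology_group q (top_of_set Z) (Z - S)
      \<cong> relative_homology_group (q - int (card E)) (top_of_set X) (X - S)" for q
    using insert.IH[of q] insert.prems unfolding Z_def by (auto simp: pairwise_insert)
  have Ze: "z \<bullet> e = 0" if "z \<in> Z" for z
  proof -
    have "(z - (\<Sum>f\<in>E. (z \<bullet> f) *\<^sub>R f)) \<bullet> e = 0"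
      using that insert.prems(3)[of _ e] by (simp add: Z_def)
    then show ?thesis
      using orth(2) by (simp add: inner_diff_left inner_sum_left)
  qed
  \<comment> \<open>Subtracting the component along \<open>e\<close> leaves the coefficients along
    \<open>E\<close> unchanged, so the projections compose.\<close>
  have eq: "{y. y - (\<Sum>f\<in>insert e E. (y \<bullet> f) *\<^sub>R f) \<in> X} = {y. y - (y \<bullet> e) *\<^sub>R e \<in> Z}"
    using insert.hyps orth by (simp add: Z_def inner_diff_left diff_diff_eq)
  have "relative_homology_group p (top_of_set {y. y - (y \<bullet> e) *\<^sub>R e \<in> Z}) ({y. y - (y \<bullet> e) *\<^sub>R e \<in> Z} - S)
      \<cong> relative_homology_group (p - 1) (top_of_set Z) (Z - S)"
    by (rule relative_homology_line_thickening(1)[OF \<open>e \<bullet> e = 1\<close> Ze IH(1)])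
  also note IH(2)
  finally show ?case
    using relative_homology_line_thickening(2)[OF \<open>e \<bullet> e = 1\<close> Ze IH(1)] insert.hyps
    unfolding eq by (simp add: algebra_simps)
qed

theorem homology_thom_isomorphism:
  fixes U W :: "'a::euclidean_space set"
  assumes U: "open U" and W: "subspace W"
  shows "relative_homology_group p (top_of_set U) (U - W)
      \<cong> homology_group (p - int (DIM('a) - dim W)) (top_of_set (U \<inter> W))"
proof -
  define N where "N = {y. \<forall>x\<in>W. orthogonal x y}"
  have "subspace N" unfolding N_def by (rule subspace_orthogonal_to_vectors)
  then obtain E where E: "E \<subseteq> N" "pairwise orthogonal E" "\<And>e. e \<in> E \<Longrightarrow> norm e = 1"
    "independent E" "card E = dim N" "span E = N"
    using orthonormal_basis_subspace by blast
  have "finite E" using E(4) by (rule independent_imp_finite)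
  have card: "card E = DIM('a) - dim W"
    using dim_subspace_orthogonal_to_vectors[OF W subspace_UNIV] E(5) by (simp add: N_def)
  define \<pi> where "\<pi> y = y - (\<Sum>e\<in>E. (y \<bullet> e) *\<^sub>R e)" for y
  have WE: "x \<bullet> e = 0" if "x \<in> W" "e \<in> E" for x e
    using that E(1) by (auto simp: N_def orthogonal_def)
  have \<pi>_W: "\<pi> x = x" if "x \<in> W" for x
    using WE[OF that] by (simp add: \<pi>_def)
  have "\<pi> y \<in> W" for y
  proof -
    obtain a b where ab: "a \<in> span W" "\<And>w. w \<in> span W \<Longrightarrow> orthogonal b w" "y = a + b"
      using orthogonal_subspace_decomp_exists[of W y] by metis
    have "span W = W" using W by (simp add: span_eq_iff)
    then have "a \<in> W" using ab(1) by (simp only:)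
    have "b \<in> span E"
      using ab(2) unfolding E(6) N_def by (auto simp: orthogonal_commute span_base)
    then have "(\<Sum>e\<in>E. (b \<bullet> e) *\<^sub>R e) = b"
      using orthonormal_basis_expand E(2,3) \<open>finite E\<close> by blast
    then have "\<pi> y = a" using WE[OF \<open>a \<in> W\<close>] by (simp add: \<pi>_def ab(3) inner_add_left)
    then show ?thesis using \<open>a \<in> W\<close> by simp
  qed
  define Z where "Z = U \<inter> W"
  define Y where "Y = {y. \<pi> y \<in> Z}"
  \<comment> \<open>Since \<open>\<pi>\<close> always lands in \<open>W\<close>, membership of
    \<open>\<pi> y\<close> in \<open>Z\<close> only tests \<open>U\<close>, and \<open>Y\<close> is
    a full preimage.\<close>
  have "Y = \<pi> -` U" using \<open>\<And>y. \<pi> y \<in> W\<close> by (auto simp: Y_def Z_def)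
  moreover have "continuous_on UNIV \<pi>" unfolding \<pi>_def by (intro continuous_intros)
  ultimately have "open Y" using U by (simp add: open_vimage)
  have "Z \<subseteq> Y" using \<pi>_W by (auto simp: Y_def Z_def)
  \<comment> \<open>The thickening is applied with both sets equal to \<open>Z\<close>, so
    \<open>Z - Z\<close> is empty and the right-hand side is absolute homology.\<close>
  have thick: "closedin (top_of_set Y) Z"
    "relative_homology_group p (top_of_set Y) (Y - Z)
      \<cong> relative_homology_group (p - int (card E)) (top_of_set Z) (Z - Z)"
    using relative_homology_orthonormal_thickening[OF \<open>finite E\<close> E(2,3), of Z Z p] WE
    unfolding Y_def \<pi>_def by (auto simp: Z_def)
  \<comment> \<open>Neither of \<open>U\<close> and \<open>Y\<close> need contain the other, so both
    are compared with \<open>U \<inter> Y\<close>.\<close>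
  have "closedin (top_of_set U) Z"
    unfolding Z_def by (rule closedin_closed_Int) (rule closed_subspace[OF W])
  then have 1: "relative_homology_group p (top_of_set (U \<inter> Y)) (U \<inter> Y - Z)
      \<cong> relative_homology_group p (top_of_set U) (U - Z)"
    using \<open>open Y\<close> \<open>Z \<subseteq> Y\<close>
    by (intro relative_homology_excise_complement) (auto simp: openin_open_Int Z_def)
  have 2: "relative_homology_group p (top_of_set (U \<inter> Y)) (U \<inter> Y - Z)
      \<cong> relative_homology_group p (top_of_set Y) (Y - Z)"
    using U \<open>Z \<subseteq> Y\<close> openin_open_Int[of U Y]
    by (intro relative_homology_excise_complement thick(1)) (auto simp: Int_commute Z_def)
  have "relative_homology_group p (top_of_set U) (U - Z)
      \<cong> relative_homology_group (p - int (card E)) (top_of_set Z) (Z - Z)"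
    by (rule iso_trans[OF group.iso_sym[OF group_relative_homology_group 1] iso_trans[OF 2 thick(2)]])
  moreover have "U - Z = U - W" by (auto simp: Z_def)
  ultimately show ?thesis by (simp add: card Z_def)
qed

subsection \<open>Real dimension of complex subspaces\<close>

lemma complex_vec_scale:
  fixes x :: "complex ^ 'n"
  shows "c *s x = Re c *\<^sub>R x + Im c *\<^sub>R (\<i> *s x)"
  by (simp add: vec_eq_iff complex_eq_iff)

lemma subspace_real_of_complex:
  fixes W :: "(complex ^ 'n) set"
  assumes "vec.subspace W" shows "subspace W"
proof -
  have "r *\<^sub>R x = of_real r *s x" for r and x :: "complex ^ 'n"
    by (simp add: vec_eq_iff complex_eq_iff)
  then show ?thesis
    using assms by (simp add: subspace_def vec.subspace_def)
qed

lemma real_dim_complex_subspace_le: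
  fixes W :: "(complex ^ 'n) set"
  assumes "vec.subspace W" shows "dim W \<le> 2 * vec.dim W"
proof -
  obtain B where B: "B \<subseteq> W" "vec.independent B" "W \<subseteq> vec.span B" "card B = vec.dim W"
    using vec.basis_exists by blast
  have fin: "finite B" using B(2) by (rule vec.finiteI_independent)
  let ?C = "B \<union> (*s) \<i> ` B"
  \<comment> \<open>Multiplication by \<open>\<i>\<close> swaps the two halves of \<open>?C\<close>
    up to sign, which makes their real span a complex subspace.\<close>
  have i: "\<i> *s x \<in> span ?C" if "x \<in> span ?C" for x
    using that
  proof (induction rule: span_induct_alt)
    case base
    then show ?case by (simp add: span_zero)
  next
    case (step c x y)
    have "\<i> *s x \<in> span ?C"
    proof (cases "x \<in> B")
      case True
      then show ?thesis by (intro span_base) auto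
    next
      case False
      then obtain b where "b \<in> B" "x = \<i> *s b" using step by auto
      then have "\<i> *s x = - b" by (simp add: vec_eq_iff)
      then show ?thesis using \<open>b \<in> B\<close> by (simp add: span_neg span_base)
    qed
    moreover have "\<i> *s (c *\<^sub>R x + y) = c *\<^sub>R (\<i> *s x) + \<i> *s y"
      by (simp add: vec_eq_iff algebra_simps)
    ultimately show ?case using step by (simp add: span_add span_scale)
  qed
  have "vec.subspace (span ?C)"
    unfolding vec.subspace_def
  proof (intro conjI ballI allI)
    fix c :: complex and x assume "x \<in> span ?C"
    then show "c *s x \<in> span ?C"
      by (subst complex_vec_scale) (intro span_add span_scale i)
  qed (simp_all add: span_zero span_add)
  then have "vec.span B \<subseteq> span ?C"
    by (intro vec.span_minimal) (auto intro: span_base)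
  then have "dim W \<le> card ?C"
    using B(3) fin by (intro dim_le_card) auto
  also have "\<dots> \<le> card B + card ((*s) \<i> ` B)" by (rule card_Un_le)
  also have "\<dots> \<le> 2 * vec.dim W" using card_image_le[OF fin, of "(*s) \<i>"] B(4) by simp
  finally show ?thesis .
qed

text \<open>Instead of proving the doubled basis independent over the reals, the upper bound is
  applied to a complex complement as well. The two real dimensions add up to at least
  \<open>2 * CARD('n)\<close>, which forces equality.\<close>

lemma real_dim_complex_subspace:
  fixes W :: "(complex ^ 'n) set"
  assumes W: "vec.subspace W" shows "dim W = 2 * vec.dim W"
proof (rule antisym[OF real_dim_complex_subspace_le[OF W]])
  obtain B where B: "B \<subseteq> W" "vec.independent B" "W \<subseteq> vec.span B" "card B = vec.dim W"
    using vec.basis_exists by blast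
  define C where "C = vec.extend_basis B - B"
  have ext: "vec.independent (vec.extend_basis B)" "B \<subseteq> vec.extend_basis B" "vec.span (vec.extend_basis B) = UNIV"
    using B(2) by (simp_all add: vec.independent_extend_basis vec.extend_basis_superset)
  have fin: "finite (vec.extend_basis B)" using ext(1) by (rule vec.finiteI_independent)
  have "vec.dim (UNIV :: (complex ^ 'n) set) = card (vec.extend_basis B)"
    by (rule vec.dim_eq_card) (simp_all add: ext)
  then have "card (vec.extend_basis B) = CARD('n)" by (simp only: vec_dim_card)
  then have "card C = CARD('n) - vec.dim W"
    using fin ext(2) B(4) by (simp add: C_def card_Diff_subset finite_subset[OF ext(2)])
  moreover have "vec.dim (vec.span C) \<le> card C"
    using vec.dim_le_card'[of C] fin by (simp add: C_def)
  ultimately have dimC: "dim (vec.span C) \<le> 2 * (CARD('n) - vec.dim W)"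
    using real_dim_complex_subspace_le[of "vec.span C"] by simp
  have spW: "vec.span B = W" using B(1,3) W by (simp add: vec.span_subspace)
  have "vec.extend_basis B = B \<union> C" using ext(2) by (auto simp: C_def)
  then have "{x + y |x y. x \<in> W \<and> y \<in> vec.span C} = UNIV"
    using ext(3) vec.span_Un[of B C] spW by auto
  moreover have "dim {x + y |x y. x \<in> W \<and> y \<in> vec.span C} + dim (W \<inter> vec.span C)
      = dim W + dim (vec.span C)"
    using W by (intro dim_sums_Int) (simp_all add: subspace_real_of_complex)
  ultimately have "2 * CARD('n) \<le> dim W + dim (vec.span C)"
    by simp
  moreover have "vec.dim W \<le> CARD('n)"
    using vec.dim_subset[OF subset_UNIV[of W]] by (simp only: vec_dim_card)
  ultimately show "2 * vec.dim W \<le> dim W" using dimC by simp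
qed

subsection \<open>Deletion and restriction\<close>

lemma csubspace_arrangement_closed:
  assumes "csubspace_arrangement \<A>" "x \<in> \<A>" shows "closed x"
  using assms by (auto simp: csubspace_arrangement_def intro: closed_subspace subspace_real_of_complex)

lemma open_arr_complement_deleted:
  assumes "csubspace_arrangement \<A>" shows "open (arr_complement (deleted_arr \<A> x0))"
proof -
  have "closed (\<Union>(\<A> - {x0}))"
    using assms by (intro closed_Union) (auto simp: csubspace_arrangement_closed csubspace_arrangement_def)
  then show ?thesis
    by (simp add: arr_complement_def deleted_arr_def open_Compl flip: Compl_eq_Diff_UNIV)
qed

lemma arr_complement_eq_Diff:
  "x0 \<in> \<A> \<Longrightarrow> arr_complement \<A> = arr_complement (deleted_arr \<A> x0) - x0"
  by (auto simp: arr_complement_def deleted_arr_def)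

text \<open>Among finitely many intersections each lies in a maximal one, so discarding the others
  does not change the union.\<close>

lemma restricted_complement_eq_Int:
  assumes "finite \<A>"
  shows "restricted_complement \<A> x0 = arr_complement (deleted_arr \<A> x0) \<inter> x0"
proof -
  let ?T = "(\<lambda>y. x0 \<inter> y) ` deleted_arr \<A> x0"
  have "finite ?T" using assms by (simp add: deleted_arr_def)
  have "\<exists>z\<in>restricted_arr \<A> x0. x0 \<inter> y \<subseteq> z" if "y \<in> deleted_arr \<A> x0" for y
  proof -
    have "x0 \<inter> y \<in> ?T" using that by blast
    from finite_has_maximal2[OF \<open>finite ?T\<close> this]
    obtain m where m: "m \<in> ?T" "x0 \<inter> y \<subseteq> m" "\<forall>b\<in>?T. m \<subseteq> b \<longrightarrow> m = b" by blast
    from m(3) have "\<not> (\<exists>w\<in>?T. m \<subset> w)" by (auto simp only: psubset_eq)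
    with m(1) have "m \<in> restricted_arr \<A> x0" unfolding restricted_arr_def Let_def by (intro CollectI conjI)
    with m(2) show ?thesis ..
  qed
  then have "x0 \<inter> \<Union>(deleted_arr \<A> x0) \<subseteq> \<Union>(restricted_arr \<A> x0)" by blast
  moreover have "restricted_arr \<A> x0 \<subseteq> ?T" by (auto simp: restricted_arr_def Let_def)
  then have "\<Union>(restricted_arr \<A> x0) \<subseteq> x0 \<inter> \<Union>(deleted_arr \<A> x0)" by blast
  ultimately have "\<Union>(restricted_arr \<A> x0) = x0 \<inter> \<Union>(deleted_arr \<A> x0)" by (rule subset_antisym[rotated])
  then show ?thesis by (auto simp: restricted_complement_def arr_complement_def)
qed

lemma homology_pair_arr_complement:
  fixes \<A> :: "(complex ^ 'n) set set"
  assumes \<A>: "csubspace_arrangement \<A>" and x0: "x0 \<in> \<A>"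
  shows "homology_group (p - 2 * int (ccodim x0)) (top_of_set (restricted_complement \<A> x0))
    \<cong> relative_homology_group p (top_of_set (arr_complement (deleted_arr \<A> x0))) (arr_complement \<A>)"
proof -
  have sub: "vec.subspace x0" "finite \<A>" using \<A> x0 by (auto simp: csubspace_arrangement_def)
  have "vec.dim x0 \<le> CARD('n)"
    using vec.dim_subset[OF subset_UNIV[of x0]] by (simp only: vec_dim_card)
  then have "int (DIM(complex ^ 'n) - dim x0) = 2 * int (ccodim x0)"
    by (simp add: real_dim_complex_subspace[OF sub(1)] ccodim_def)
  with homology_thom_isomorphism
    [OF open_arr_complement_deleted[OF \<A>, of x0] subspace_real_of_complex[OF sub(1)], of p]
  have "relative_homology_group p (top_of_set (arr_complement (deleted_arr \<A> x0)))
      (arr_complement (deleted_arr \<A> x0) - x0)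
    \<cong> homology_group (p - 2 * int (ccodim x0)) (top_of_set (arr_complement (deleted_arr \<A> x0) \<inter> x0))"
    by (simp only:)
  then show ?thesis
    unfolding arr_complement_eq_Diff[OF x0] restricted_complement_eq_Int[OF sub(2)]
    by (rule group.iso_sym[OF group_relative_homology_group])
qed

theorem theorem4p1:
  fixes \<A> :: "(complex ^ 'n) set set" and x0 :: "(complex ^ 'n) set"
  assumes "csubspace_arrangement \<A>" and "x0 \<in> \<A>"
  defines "d \<equiv> 2 * int (ccodim x0) - 1"
  shows "\<exists>g h.
    \<forall>q::int.
      cohom_linear q (subtopology euclidean (arr_complement \<A>))
                   (q - d) (subtopology euclidean (restricted_complement \<A> x0)) (g q)
    \<and> cohom_linear (q - d) (subtopology euclidean (restricted_complement \<A> x0))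
                   (q + 1) (subtopology euclidean (arr_complement (deleted_arr \<A> x0))) (h q)
    \<and> cohom_exact q (subtopology euclidean (arr_complement (deleted_arr \<A> x0)))
                  q (subtopology euclidean (arr_complement \<A>))
                  (q - d) (subtopology euclidean (restricted_complement \<A> x0))
                  (cohom_restrict q (subtopology euclidean (arr_complement (deleted_arr \<A> x0)))
                                    (arr_complement \<A>))
                  (g q)
    \<and> cohom_exact q (subtopology euclidean (arr_complement \<A>))
                  (q - d) (subtopology euclidean (restricted_complement \<A> x0))
                  (q + 1) (subtopology euclidean (arr_complement (deleted_arr \<A> x0)))
                  (g q) (h q)
    \<and> cohom_exact (q - d) (subtopology euclidean (restricted_complement \<A> x0))
                  (q + 1) (subtopology euclidean (arr_complement (deleted_arr \<A> x0)))
                  (q + 1) (subtopology euclidean (arr_complement \<A>))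
                  (h q)
                  (cohom_restrict (q + 1) (subtopology euclidean (arr_complement (deleted_arr \<A> x0)))
                                    (arr_complement \<A>))"
proof -
  define U M Z where "U = top_of_set (arr_complement (deleted_arr \<A> x0))"
    and "M = arr_complement \<A>" and "Z = top_of_set (restricted_complement \<A> x0)"
  have UM: "subtopology U M = top_of_set M"
    using arr_complement_eq_Diff[OF assms(2)]
    by (auto simp: U_def M_def subtopology_subtopology intro!: arg_cong[of _ _ "subtopology euclidean"])
  have "\<exists>\<theta>. \<theta> \<in> iso (homology_group (q - d) Z) (relative_homology_group (q + 1) U M)" for q
  proof -
    \<comment> \<open>The relative group sits in degree \<open>q + 1\<close>, one above the group of
      \<open>M\<close> that its boundary map reaches; this accounts for the 1 in
      \<open>d\<close>.\<close>
    have "q - d = q + 1 - 2 * int (ccodim x0)" by (simp add: d_def)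
    then have "homology_group (q - d) Z \<cong> relative_homology_group (q + 1) U M"
      using homology_pair_arr_complement[OF assms(1,2), of "q + 1"]
      unfolding U_def M_def Z_def by (simp only:)
    then show ?thesis by (auto simp: is_iso_def)
  qed
  then have "\<forall>q. \<exists>\<theta>. \<theta> \<in> iso (homology_group (q - d) Z) (relative_homology_group (q + 1) U M)"
    by blast
  from choice[OF this] obtain \<theta>
    where \<theta>: "\<And>q. \<theta> q \<in> iso (homology_group (q - d) Z) (relative_homology_group (q + 1) U M)"
    by blast
  define \<eta> where "\<eta> q = inv_into (carrier (homology_group (q - d) Z)) (\<theta> q)" for q
  have \<eta>: "\<eta> q \<in> iso (relative_homology_group (q + 1) U M) (homology_group (q - d) Z)" for q
    unfolding \<eta>_def by (rule group.iso_set_sym[OF group_relative_homology_group \<theta>])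
  have \<eta>\<theta>: "\<eta> q (\<theta> q a) = a" if "a \<in> carrier (homology_group (q - d) Z)" for q a
    using \<theta>[of q] that by (simp add: \<eta>_def iso_def bij_betw_def)
  have \<theta>\<eta>: "\<theta> q (\<eta> q a) = a" if "a \<in> carrier (relative_homology_group (q + 1) U M)" for q a
    unfolding \<eta>_def using \<theta>[of q] that by (intro bij_betw_inv_into_right) (auto simp: iso_def)
  let ?i = "\<lambda>q. hom_induced q (top_of_set M) {} U {} id"
  let ?j = "\<lambda>q. hom_induced (q + 1) U {} U M id"
  let ?bd = "\<lambda>q. hom_boundary (q + 1) U M"
  \<comment> \<open>Both maps run against the arrows of the cohomology sequence; the transposes of
    \<open>\<alpha>\<close> and \<open>\<beta>\<close> are the witnesses for \<open>g\<close> and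
    \<open>h\<close>.\<close>
  define \<alpha> where "\<alpha> q = ?bd q \<circ> \<theta> q" for q
  define \<beta> where "\<beta> q = \<eta> q \<circ> ?j q" for q
  have i: "?i q \<in> hom (homology_group q (top_of_set M)) (homology_group q U)" for q
    by (rule hom_induced_hom)
  have bd: "?bd q \<in> hom (relative_homology_group (q + 1) U M) (homology_group q (top_of_set M))" for q
    using hom_boundary_hom[of "q + 1" U M] by (simp add: UM)
  have \<alpha>: "\<alpha> q \<in> hom (homology_group (q - d) Z) (homology_group q (top_of_set M))" for q
    unfolding \<alpha>_def by (rule hom_compose[OF iso_imp_homomorphism[OF \<theta>] bd])
  have \<beta>: "\<beta> q \<in> hom (homology_group (q + 1) U) (homology_group (q - d) Z)" for q
    unfolding \<beta>_def by (rule hom_compose[OF hom_induced_hom iso_imp_homomorphism[OF \<eta>]])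
  have ex_i: "?bd q ` carrier (relative_homology_group (q + 1) U M)
      = kernel (homology_group q (top_of_set M)) (homology_group q U) (?i q)" for q
    using homology_exactness_axiom_2[of "q + 1" U M] by (simp add: UM)
  have ex_bd: "?j q ` carrier (homology_group (q + 1) U)
      = kernel (relative_homology_group (q + 1) U M) (homology_group q (top_of_set M)) (?bd q)" for q
    using homology_exactness_axiom_1[of "q + 1" U M] by (simp add: UM)
  have ex_j: "?i (q + 1) ` carrier (homology_group (q + 1) (top_of_set M))
      = kernel (homology_group (q + 1) U) (relative_homology_group (q + 1) U M) (?j q)" for q
    using homology_exactness_axiom_3[of "q + 1" U M] by (simp add: UM)
  have \<theta>_onto: "\<theta> q ` carrier (homology_group (q - d) Z) = carrier (relative_homology_group (q + 1) U M)" for q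
    using \<theta>[of q] by (simp add: iso_def bij_betw_def)
  have 1: "\<alpha> q ` carrier (homology_group (q - d) Z)
      = kernel (homology_group q (top_of_set M)) (homology_group q U) (?i q)" for q
    unfolding \<alpha>_def image_comp[symmetric] \<theta>_onto by (rule ex_i)
  have 2: "\<beta> q ` carrier (homology_group (q + 1) U)
      = kernel (homology_group (q - d) Z) (homology_group q (top_of_set M)) (\<alpha> q)" for q
  proof -
    have "\<beta> q ` carrier (homology_group (q + 1) U)
        = \<eta> q ` kernel (relative_homology_group (q + 1) U M) (homology_group q (top_of_set M)) (?bd q)"
      unfolding \<beta>_def image_comp[symmetric] ex_bd ..
    also have "\<dots> = kernel (homology_group (q - d) Z) (homology_group q (top_of_set M)) (\<alpha> q)"
    proof (intro subset_antisym subsetI)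
      fix a assume "a \<in> \<eta> q ` kernel (relative_homology_group (q + 1) U M) (homology_group q (top_of_set M)) (?bd q)"
      then show "a \<in> kernel (homology_group (q - d) Z) (homology_group q (top_of_set M)) (\<alpha> q)"
        using hom_in_carrier[OF iso_imp_homomorphism[OF \<eta>[of q]]] \<theta>\<eta>
        by (auto simp: kernel_def \<alpha>_def)
    next
      fix a assume a: "a \<in> kernel (homology_group (q - d) Z) (homology_group q (top_of_set M)) (\<alpha> q)"
      then have "\<theta> q a \<in> kernel (relative_homology_group (q + 1) U M) (homology_group q (top_of_set M)) (?bd q)"
        using hom_in_carrier[OF iso_imp_homomorphism[OF \<theta>[of q]]] by (auto simp: kernel_def \<alpha>_def)
      moreover have "a = \<eta> q (\<theta> q a)" using a \<eta>\<theta> by (simp add: kernel_def)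
      ultimately show "a \<in> \<eta> q ` kernel (relative_homology_group (q + 1) U M) (homology_group q (top_of_set M)) (?bd q)"
        by (rule rev_image_eqI)
    qed
    finally show ?thesis .
  qed
  have 3: "?i (q + 1) ` carrier (homology_group (q + 1) (top_of_set M))
      = kernel (homology_group (q + 1) U) (homology_group (q - d) Z) (\<beta> q)" for q
  proof -
    \<comment> \<open>Composition with the injective \<open>\<eta>\<close> does not change the
      kernel of \<open>?j q\<close>.\<close>
    have "\<eta> q b = \<one>\<^bsub>homology_group (q - d) Z\<^esub> \<longleftrightarrow> b = \<one>\<^bsub>relative_homology_group (q + 1) U M\<^esub>"
      if "b \<in> carrier (relative_homology_group (q + 1) U M)" for b
    proof -
      have inj: "inj_on (\<eta> q) (carrier (relative_homology_group (q + 1) U M))"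
        using \<eta>[of q] by (simp add: iso_def bij_betw_def)
      have one: "\<eta> q \<one>\<^bsub>relative_homology_group (q + 1) U M\<^esub> = \<one>\<^bsub>homology_group (q - d) Z\<^esub>"
        by (rule hom_one[OF iso_imp_homomorphism[OF \<eta>]]) simp_all
      show ?thesis
        unfolding one[symmetric]
        by (rule inj_on_eq_iff[OF inj that]) (simp add: group.is_monoid)
    qed
    then show ?thesis
      using hom_in_carrier[OF hom_induced_hom[of "q + 1" U "{}" U M id]]
      unfolding ex_j by (auto simp: kernel_def \<beta>_def)
  qed
  \<comment> \<open>The restriction map is prescribed by the statement, so it is identified with the
    transpose of \<open>?i q\<close> before duality applies.\<close>
  have restrict: "cohom_restrict q U M A = dual_map q U q (top_of_set M) (?i q) A"
    if "A \<in> rat_cohomology q U" for q A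
    using cohom_restrict_eq_dual_map[OF that, of M] by (simp add: UM)
  have ex1: "cohom_exact q U q (top_of_set M) (q - d) Z (cohom_restrict q U M) (dual_map q (top_of_set M) (q - d) Z (\<alpha> q))" for q
    using cohom_exact_dual_map[OF i \<alpha> 1, of q]
    by (simp only: cohom_exact_cong[OF restrict refl])
  have ex3: "cohom_exact (q - d) Z (q + 1) U (q + 1) (top_of_set M)
      (dual_map (q - d) Z (q + 1) U (\<beta> q)) (cohom_restrict (q + 1) U M)" for q
    using cohom_exact_dual_map[OF \<beta> i 3, of q]
    by (simp only: cohom_exact_cong[OF refl restrict])
  have ex2: "cohom_exact q (top_of_set M) (q - d) Z (q + 1) U
      (dual_map q (top_of_set M) (q - d) Z (\<alpha> q)) (dual_map (q - d) Z (q + 1) U (\<beta> q))" for q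
    by (rule cohom_exact_dual_map[OF \<alpha> \<beta> 2])
  show ?thesis
    unfolding U_def[symmetric] M_def[symmetric] Z_def[symmetric]
    by (rule exI[of _ "\<lambda>q. dual_map q (top_of_set M) (q - d) Z (\<alpha> q)"],
        rule exI[of _ "\<lambda>q. dual_map (q - d) Z (q + 1) U (\<beta> q)"])
       (rule allI, rule conjI[OF cohom_linear_dual_map[OF \<alpha>]
          conjI[OF cohom_linear_dual_map[OF \<beta>] conjI[OF ex1 conjI[OF ex2 ex3]]]])
qed

end
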